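(* Let $A$ and $B$ be $A_\infty$-algebras, let $n\geqslant 2$, $0<k<n$, and let $\mathsf\Lambda^k_n\to\mathrm{HOM}_{A_\infty}(A,B)_\bullet$ be an inner horn. Then sending a filler $\Delta^n\to\mathrm{HOM}_{A_\infty}(A,B)_\bullet$ of this horn, i.e. an $n$-morphism $(F_I^{(m)})_{I\subset\Delta^n,\,m\geqslant1}$ restricting to the given horn, to the family $(F^{(m)}_{\Delta^n})_{m\geqslant1}$ of its components on the top face defines a one-to-one correspondence between the set of fillers of the horn and the set of all families of degree $-n$ maps $F^{(m)}_{\Delta^n}:(sA)^{\otimes m}\to sB$, $m\geqslant1$.
   Context: Everything is over $\mathbb{Z}$, cohomologically graded, with the Koszul sign rule; $(sA)^i:=A^{i+1}$. An $A_\infty$-algebra is a graded module $A$ with degree $+1$ maps $b_m:(sA)^{\otimes m}\to sA$, $m\geqslant1$, such that $\sum_{i_1+i_2+i_3=m}b_{i_1+1+i_3}(\mathrm{id}^{\otimes i_1}\otimes b_{i_2}\otimes\mathrm{id}^{\otimes i_3})=0$ for all $m$. An overlapping partition $I_1\cup\dots\cup I_s=I$ of a face $I$ of the standard simplex $\Delta^n$ is a sequence of faces of $I$ with union $I$ and $\max(I_\ell)=\min(I_{\ell+1})$ for $1\le\ell<s$. An $n$-morphism from $A$ to $B$ is a family of maps $F_I^{(m)}:(sA)^{\otimes m}\to sB$ of degree $|I|=-\dim I$, for all faces $I\subset\Delta^n$ and $m\geqslant1$, such that $$\sum_{j=0}^{\dim I}(-1)^jF^{(m)}_{\partial_jI}+(-1)^{|I|}\sum_{i_1+i_2+i_3=m}F_I^{(i_1+1+i_3)}(\mathrm{id}^{\otimes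 i_1}\otimes b_{i_2}\otimes\mathrm{id}^{\otimes i_3})=\sum_{i_1+\dots+i_s=m,\ I_1\cup\dots\cup I_s=I}b_s(F^{(i_1)}_{I_1}\otimes\dots\otimes F^{(i_s)}_{I_s}),$$ the last sum being over overlapping partitions (the first sum is absent if $\dim I=0$). Equivalently it is a morphism of dg-coalgebras $\pmb\Delta^n\otimes\overline T(sA)\to\overline T(sB)$, where $\pmb\Delta^n$ is the dg-coalgebra of faces of $\Delta^n$ with simplicial differential and Alexander–Whitney coproduct. The $n$-morphisms form the $n$-simplices of a simplicial set $\mathrm{HOM}_{A_\infty}(A,B)_\bullet$, whose face maps are restrictions to faces of $\Delta^n$ and whose $i$-th degeneracy sends $(F_I)$ to the family indexed by faces $J\subset\Delta^{n+1}$ equal to $F_{\sigma_i(J)}$ if $J\not\supset[i<i+1]$ and to $0$ otherwise, $\sigma_i$ being the map on vertices collapsing $i$ and $i+1$. $\mathsf\Lambda^k_n$ is the horn obtained from $\Delta^n$ by removing the faces $[0<\dots<n]$ and $[0<\dots<\widehat{k}<\dots<n]$; a map from it to $\mathrm{HOM}_{A_\infty}(A,B)_\bullet$ is a family of maps $F_I^{(m)}:(sA)^{\otimes m}\to sB$ of degree $-\dim I$, indexed by the faces $I$ of $\mathsf\Lambda^k_n$ and $m\geqslant1$, satisfying for every face $I$ of $\mathsf\Lambda^k_n$ and every $m\geqslant1$ the equation $$\sum_{j=0}^{\dim I}(-1)^jF^{(m)}_{\partial_jI}+(-1)^{|I|}\sum_{i_1+i_2+i_3=m}F_I^{(i_1+1+i_3)}(\mathrm{id}^{\otimes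 i_1}\otimes b_{i_2}\otimes\mathrm{id}^{\otimes i_3})=\sum_{i_1+\dots+i_s=m,\ I_1\cup\dots\cup I_s=I}b_s(F^{(i_1)}_{I_1}\otimes\dots\otimes F^{(i_s)}_{I_s}),$$ the last sum being over overlapping partitions of $I$ (and the first sum being absent if $\dim I=0$). *)

theory Defs
  imports Complex_Main "HOL-Library.FuncSet"
begin

section \<open>Graded modules and homogeneous multilinear maps\<close>

text \<open>
  A graded \<open>\<int>\<close>-module is the abelian group \<open>'a\<close> together with subgroups \<open>A i\<close> whose internal
  direct sum is all of \<open>'a\<close>.
\<close>

locale graded_module =
  fixes A :: "int \<Rightarrow> 'a::ab_group_add set"
  assumes zero_mem: "0 \<in> A i"
    and add_mem: "x \<in> A i \<Longrightarrow> y \<in> A i \<Longrightarrow> x + y \<in> A i"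
    and uminus_mem: "x \<in> A i \<Longrightarrow> - x \<in> A i"
    and direct_sum: "\<exists>!c. (\<forall>i. c i \<in> A i) \<and> finite {i. c i \<noteq> 0} \<and> x = (\<Sum>i | c i \<noteq> 0. c i)"

definition shift :: "(int \<Rightarrow> 'a set) \<Rightarrow> int \<Rightarrow> 'a set" where
  "shift A i = A (i + 1)"

text \<open>
  A linear map out of the \<open>m\<close>-th tensor power of \<open>V\<close> is represented by the corresponding multilinear
  map, i.e. by its values on elementary tensors; the list \<open>[x\<^sub>1, \<dots>, x\<^sub>m]\<close> stands for
  \<open>x\<^sub>1 \<otimes> \<dots> \<otimes> x\<^sub>m\<close>. Such maps are \<open>undefined\<close> on lists of any other length, so that equality of maps is
  equality of functions. Linearity over \<open>\<int>\<close> is additivity.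
\<close>

definition multilinear :: "nat \<Rightarrow> ('a::ab_group_add list \<Rightarrow> 'b::ab_group_add) \<Rightarrow> bool" where
  "multilinear m f \<longleftrightarrow>
     (\<forall>xs x y ys. length xs + 1 + length ys = m \<longrightarrow>
        f (xs @ [x + y] @ ys) = f (xs @ [x] @ ys) + f (xs @ [y] @ ys))"

definition homogeneous :: "(int \<Rightarrow> 'a set) \<Rightarrow> int list \<Rightarrow> 'a list \<Rightarrow> bool" where
  "homogeneous V ps xs \<longleftrightarrow> list_all2 (\<lambda>p x. x \<in> V p) ps xs"

definition graded_maps ::
  "(int \<Rightarrow> 'a::ab_group_add set) \<Rightarrow> (int \<Rightarrow> 'b::ab_group_add set) \<Rightarrow> nat \<Rightarrow> int \<Rightarrow> ('a list \<Rightarrow> 'b) set"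
  where
  "graded_maps V W m d =
     {f \<in> extensional {xs. length xs = m}. multilinear m f \<and>
        (\<forall>ps xs. length xs = m \<longrightarrow> homogeneous V ps xs \<longrightarrow> f xs \<in> W (sum_list ps + d))}"


section \<open>Tensor products of maps and the Koszul sign rule\<close>

definition signed :: "int \<Rightarrow> 'a::ab_group_add \<Rightarrow> 'a" where
  "signed e x = (if even e then x else - x)"

text \<open>
  A triple \<open>(i, d, f)\<close> is a map of arity \<open>i\<close> and degree \<open>d\<close>. On elements \<open>xs\<close> of degrees \<open>ps\<close>, the tensor
  product \<open>f\<^sub>1 \<otimes> \<dots> \<otimes> f\<^sub>s\<close> has the value \<open>tensor_values fs xs\<close> up to the sign with exponent
  \<open>koszul fs ps\<close>; the latter iterates \<open>(f \<otimes> g)(x \<otimes> y) = (-1)\<^bsup>|g| |x|\<^esup> f(x) \<otimes> g(y)\<close>.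
\<close>

type_synonym ('a, 'b) hmap = "nat \<times> int \<times> ('a list \<Rightarrow> 'b)"

fun tensor_values :: "('a, 'b) hmap list \<Rightarrow> 'a list \<Rightarrow> 'b list" where
  "tensor_values [] xs = []"
| "tensor_values ((i, d, f) # fs) xs = f (take i xs) # tensor_values fs (drop i xs)"

fun koszul :: "('a, 'b) hmap list \<Rightarrow> int list \<Rightarrow> int" where
  "koszul [] ps = 0"
| "koszul ((i, d, f) # fs) ps =
     (\<Sum>(i', d', f') \<leftarrow> fs. d') * sum_list (take i ps) + koszul fs (drop i ps)"

text \<open>\<open>g \<circ> (f\<^sub>1 \<otimes> \<dots> \<otimes> f\<^sub>s)\<close>, evaluated at elements \<open>xs\<close> of degrees \<open>ps\<close>.\<close>

definition comp_tensor ::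
  "('b list \<Rightarrow> 'c::ab_group_add) \<Rightarrow> ('a, 'b) hmap list \<Rightarrow> int list \<Rightarrow> 'a list \<Rightarrow> 'c" where
  "comp_tensor g fs ps xs = signed (koszul fs ps) (g (tensor_values fs xs))"

text \<open>The identity of \<open>V\<close> is the unary map \<open>hd\<close> on one-element lists.\<close>

definition id_map :: "('a, 'a) hmap" where
  "id_map = (1, 0, hd)"

definition insertions :: "nat \<Rightarrow> (nat \<times> nat \<times> nat) set" where
  "insertions m = {(i1, i2, i3). 1 \<le> i2 \<and> i1 + i2 + i3 = m}"

text \<open>\<open>\<Sum> g\<^bsup>(i\<^sub>1 + 1 + i\<^sub>3)\<^esup> (id\<^bsup>\<otimes>i\<^sub>1\<^esup> \<otimes> b\<^bsub>i\<^sub>2\<^esub> \<otimes> id\<^bsup>\<otimes>i\<^sub>3\<^esup>)\<close> over \<open>i\<^sub>1 + i\<^sub>2 + i\<^sub>3 = m\<close>, the \<open>b\<^sub>i\<close> having degree 1.\<close>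

definition insertion_sum ::
  "(nat \<Rightarrow> 'a list \<Rightarrow> 'b::ab_group_add) \<Rightarrow> (nat \<Rightarrow> 'a list \<Rightarrow> 'a) \<Rightarrow> nat \<Rightarrow> int list \<Rightarrow> 'a list \<Rightarrow> 'b"
  where
  "insertion_sum g b m ps xs =
     (\<Sum>(i1, i2, i3) \<in> insertions m.
        comp_tensor (g (i1 + 1 + i3))
          (replicate i1 id_map @ [(i2, 1, b i2)] @ replicate i3 id_map) ps xs)"


section \<open>\<open>A\<^sub>\<infinity>\<close>-algebras\<close>

locale A_infinity_algebra = graded_module A
  for A :: "int \<Rightarrow> 'a::ab_group_add set" +
  fixes b :: "nat \<Rightarrow> 'a list \<Rightarrow> 'a"
  assumes b_maps: "1 \<le> m \<Longrightarrow> b m \<in> graded_maps (shift A) (shift A) m 1"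
    and A_infinity_relation:
      "1 \<le> m \<Longrightarrow> length xs = m \<Longrightarrow> homogeneous (shift A) ps xs \<Longrightarrow> insertion_sum b b m ps xs = 0"


section \<open>Faces of the standard simplex\<close>

text \<open>A face is identified with its nonempty set of vertices.\<close>

definition faces :: "nat \<Rightarrow> nat set set" where
  "faces n = {I. I \<noteq> {} \<and> I \<subseteq> {0..n}}"

definition horn_faces :: "nat \<Rightarrow> nat \<Rightarrow> nat set set" where
  "horn_faces k n = faces n - {{0..n}, {0..n} - {k}}"

definition fdim :: "nat set \<Rightarrow> nat" where
  "fdim I = card I - 1"

definition face_boundary :: "nat \<Rightarrow> nat set \<Rightarrow> nat set" where
  "face_boundary j I = I - {sorted_list_of_set I ! j}"

definition overlapping_partition :: "nat set \<Rightarrow> nat set list \<Rightarrow> bool" where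
  "overlapping_partition I Is \<longleftrightarrow>
     (\<forall>J \<in> set Is. J \<noteq> {} \<and> J \<subseteq> I) \<and> \<Union> (set Is) = I \<and>
     (\<forall>l. l + 1 < length Is \<longrightarrow> Max (Is ! l) = Min (Is ! (l + 1)))"

text \<open>
  Pairs of a decomposition \<open>i\<^sub>1 + \<dots> + i\<^sub>s = m\<close> into positive parts and an overlapping partition of \<open>I\<close>
  of the same length. There are infinitely many overlapping partitions of \<open>I\<close>, since vertices can be
  repeated, but \<open>s \<le> m\<close> bounds their length.
\<close>

definition overlapping_decompositions :: "nat set \<Rightarrow> nat \<Rightarrow> (nat list \<times> nat set list) set" where
  "overlapping_decompositions I m =
     {(ms, Is). length ms = length Is \<and> (\<forall>i \<in> set ms. 1 \<le> i) \<and> sum_list ms = m \<and>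
        overlapping_partition I Is}"

lemma finite_insertions: "finite (insertions m)"
  by (rule finite_subset[of _ "{0..m} \<times> {0..m} \<times> {0..m}"]) (auto simp: insertions_def)

lemma finite_overlapping_decompositions:
  assumes "finite I"
  shows "finite (overlapping_decompositions I m)"
proof (rule finite_subset)
  let ?L = "\<lambda>S. {l. set l \<subseteq> S \<and> length l \<le> m}"
  have len: "length ms \<le> sum_list ms" if "\<forall>i \<in> set ms. 1 \<le> i" for ms :: "nat list"
    using that by (induction ms) auto
  show "overlapping_decompositions I m \<subseteq> ?L {0..m} \<times> ?L (Pow I)"
    using len
    by (fastforce simp: overlapping_decompositions_def overlapping_partition_def
        dest: member_le_sum_list)
  show "finite (?L {0..m} \<times> ?L (Pow I))"
    using assms by (intro finite_cartesian_product finite_lists_length_le) auto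
qed


section \<open>Higher morphisms\<close>

definition morphism_equation ::
  "(int \<Rightarrow> 'a::ab_group_add set) \<Rightarrow> (nat \<Rightarrow> 'a list \<Rightarrow> 'a) \<Rightarrow> (nat \<Rightarrow> 'b::ab_group_add list \<Rightarrow> 'b) \<Rightarrow>
   (nat set \<Rightarrow> nat \<Rightarrow> 'a list \<Rightarrow> 'b) \<Rightarrow> nat set \<Rightarrow> nat \<Rightarrow> bool" where
  "morphism_equation A bA bB F I m \<longleftrightarrow>
     (\<forall>ps xs. length xs = m \<longrightarrow> homogeneous (shift A) ps xs \<longrightarrow>
        (if fdim I = 0 then 0
         else \<Sum>j = 0..fdim I. signed (int j) (F (face_boundary j I) m xs))
        + signed (- int (fdim I)) (insertion_sum (F I) bA m ps xs)
        = (\<Sum>(ms, Is) \<in> overlapping_decompositions I m.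
             comp_tensor (bB (length ms))
               (map2 (\<lambda>i J. (i, - int (fdim J), F J i)) ms Is) ps xs))"

text \<open>
  For a set \<open>K\<close> of faces closed under passing to subfaces, \<open>HOM_on A bA B bB K\<close> is the set of maps
  from the simplicial set with nondegenerate simplices \<open>K\<close> to \<open>HOM(A, B)\<close>.
\<close>

definition HOM_on ::
  "(int \<Rightarrow> 'a::ab_group_add set) \<Rightarrow> (nat \<Rightarrow> 'a list \<Rightarrow> 'a) \<Rightarrow>
   (int \<Rightarrow> 'b::ab_group_add set) \<Rightarrow> (nat \<Rightarrow> 'b list \<Rightarrow> 'b) \<Rightarrow>
   nat set set \<Rightarrow> (nat set \<Rightarrow> nat \<Rightarrow> 'a list \<Rightarrow> 'b) set" where
  "HOM_on A bA B bB K =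
     {F \<in> (\<Pi>\<^sub>E I \<in> K. \<Pi>\<^sub>E m \<in> {1..}. graded_maps (shift A) (shift B) m (- int (fdim I))).
        \<forall>I \<in> K. \<forall>m \<ge> 1. morphism_equation A bA bB F I m}"

definition n_morphisms ::
  "(int \<Rightarrow> 'a::ab_group_add set) \<Rightarrow> (nat \<Rightarrow> 'a list \<Rightarrow> 'a) \<Rightarrow>
   (int \<Rightarrow> 'b::ab_group_add set) \<Rightarrow> (nat \<Rightarrow> 'b list \<Rightarrow> 'b) \<Rightarrow>
   nat \<Rightarrow> (nat set \<Rightarrow> nat \<Rightarrow> 'a list \<Rightarrow> 'b) set" where
  "n_morphisms A bA B bB n = HOM_on A bA B bB (faces n)"

definition horns ::
  "(int \<Rightarrow> 'a::ab_group_add set) \<Rightarrow> (nat \<Rightarrow> 'a list \<Rightarrow> 'a) \<Rightarrow>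
   (int \<Rightarrow> 'b::ab_group_add set) \<Rightarrow> (nat \<Rightarrow> 'b list \<Rightarrow> 'b) \<Rightarrow>
   nat \<Rightarrow> nat \<Rightarrow> (nat set \<Rightarrow> nat \<Rightarrow> 'a list \<Rightarrow> 'b) set" where
  "horns A bA B bB k n = HOM_on A bA B bB (horn_faces k n)"

definition horn_fillers ::
  "(int \<Rightarrow> 'a::ab_group_add set) \<Rightarrow> (nat \<Rightarrow> 'a list \<Rightarrow> 'a) \<Rightarrow>
   (int \<Rightarrow> 'b::ab_group_add set) \<Rightarrow> (nat \<Rightarrow> 'b list \<Rightarrow> 'b) \<Rightarrow>
   nat \<Rightarrow> nat \<Rightarrow> (nat set \<Rightarrow> nat \<Rightarrow> 'a list \<Rightarrow> 'b) \<Rightarrow> (nat set \<Rightarrow> nat \<Rightarrow> 'a list \<Rightarrow> 'b) set" where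
  "horn_fillers A bA B bB k n H =
     {F \<in> n_morphisms A bA B bB n. restrict F (horn_faces k n) = H}"

end

theory Submission
  imports Defs "HOL-Library.Groups_Big_Fun"
begin

text \<open>
  The horn lacks two faces of the simplex: the top face \<open>[n]\<close> and its facet \<open>D\<close> opposite to \<open>k\<close>. In the
  equation of \<open>[n]\<close> the map \<open>F\<^sub>D\<close> occurs exactly once, in the simplicial boundary, with coefficient \<open>(-1)\<^sup>k\<close>.
  It does not occur on the right-hand side, since the pieces of an overlapping partition of \<open>[n]\<close> are
  intervals of vertices and \<open>D\<close> contains \<open>0\<close> and \<open>n\<close> but not \<open>k\<close>. Hence for every choice of \<open>F\<close> on \<open>[n]\<close>, the
  equation of \<open>[n]\<close> has exactly one solution \<open>F\<^sub>D\<close>. What remains is to see that this solution satisfies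
  the equation of \<open>D\<close>.

  This follows from a Bianchi identity. Let \<open>\<Phi>\<close> be the coalgebra morphism from faces and words to words whose
  components are the \<open>F\<^sub>I\<close>, and let \<open>E\<^sub>I\<close> be the difference of the two sides of the equation of \<open>I\<close>. The \<open>E\<^sub>I\<close> are
  the components of \<open>\<Phi> d - d \<Phi>\<close>, which anticommutes with the differentials because these square to zero. On
  components this says that the total differential of \<open>E\<close> is minus the sum of all \<open>b(F \<otimes> \<dots> \<otimes> E \<otimes> \<dots> \<otimes> F)\<close>
  (\<open>total_codiff_defect\<close>). On \<open>[n]\<close> only intervals occur on the right, where \<open>E\<close> vanishes; on the left all
  terms vanish except \<open>(-1)\<^sup>k E\<^sub>D\<close>. So \<open>E\<^sub>D = 0\<close> (\<open>defect_omit_eq_0\<close>).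

  No tensor product is formed. Instead of operators on a tensor coalgebra, the proof uses their duals, which act
  on functions of words: the bar differential becomes \<open>codiff\<close>, deconcatenation becomes \<open>cut_sum\<close>, and
  \<open>\<Phi>\<close> becomes \<open>lift F\<close>. Faces are lists of vertices, so that the boundary omits an entry, the
  Alexander--Whitney coproduct cuts the list at an entry, and identities are proved by recursion on lists. All
  these lists may be empty, and \<open>F\<close> is taken to be 0 on the empty face. The identities hold on words of
  homogeneous elements. Since the equation of \<open>[n]\<close> prescribes \<open>F\<^sub>D\<close> only there, with signs depending on the
  degrees, it is finally extended to arbitrary elements (\<open>multilinear_extension\<close>).
\<close>


section \<open>Signs, words and additive functions\<close>

lemma signed_add: "signed e (x + y) = signed e x + signed e y"
  by (simp add: signed_def)

lemma signed_minus: "signed e (- x) = - signed e x"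
  by (simp add: signed_def)

lemma signed_diff: "signed e (x - y) = signed e x - signed e y"
  by (simp add: signed_def)

lemma signed_0 [simp]: "signed e 0 = 0"
  by (simp add: signed_def)

lemma signed_zero [simp]: "signed 0 x = x"
  by (simp add: signed_def)

lemma signed_signed: "signed e (signed f x) = signed (e + f) x"
  by (simp add: signed_def)

lemma signed_sum: "signed e (sum f S) = (\<Sum>i\<in>S. signed e (f i))"
  by (simp add: signed_def sum_negf)

lemma signed_parity: "even (e - f) \<Longrightarrow> signed e x = signed f x"
  by (auto simp: signed_def)

lemma signed_odd: "odd (e - f) \<Longrightarrow> signed e x = - signed f x"
  by (auto simp: signed_def)

text \<open>
  Each letter carries a degree, because the Koszul signs refer to degrees of elements and the zero
  element has every degree.
\<close>

type_synonym 'a word = "(int \<times> 'a) list"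

definition deg :: "'a word \<Rightarrow> int" where
  "deg w = sum_list (map fst w)"

lemma deg_simps [simp]: "deg [] = 0" "deg (z # w) = fst z + deg w" "deg (u @ v) = deg u + deg v"
  by (simp_all add: deg_def)

text \<open>
  Additivity in one letter whose degree label is kept: this is linearity on the tensor coalgebra,
  expressed on the words that span it.
\<close>

definition multiadditive :: "('a::ab_group_add word \<Rightarrow> 'c::ab_group_add) \<Rightarrow> bool" where
  "multiadditive \<phi> \<longleftrightarrow>
     (\<forall>u v p x y. \<phi> (u @ (p, x + y) # v) = \<phi> (u @ (p, x) # v) + \<phi> (u @ (p, y) # v))"

lemma multiadditiveD:
  "multiadditive \<phi> \<Longrightarrow> \<phi> (u @ (p, x + y) # v) = \<phi> (u @ (p, x) # v) + \<phi> (u @ (p, y) # v)"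
  by (auto simp: multiadditive_def)

lemma multiadditive_Cons: "multiadditive \<phi> \<Longrightarrow> multiadditive (\<lambda>w. \<phi> (z # w))"
  unfolding multiadditive_def by (metis append_Cons)

lemma multiadditive_additive: "multiadditive \<phi> \<Longrightarrow> additive (\<lambda>x. \<phi> (u @ (p, x) # v))"
  by (simp add: additive_def multiadditiveD)


section \<open>Cutting words and faces\<close>

abbreviation omit :: "nat \<Rightarrow> 'a list \<Rightarrow> 'a list" where
  "omit k I \<equiv> take k I @ drop (Suc k) I"

lemma set_omit:
  assumes "distinct I" "k < length I"
  shows "set (omit k I) = set I - {I ! k}"
proof -
  define L M where "L = take k I" and "M = drop (Suc k) I"
  have I: "I = L @ I ! k # M" unfolding L_def M_def by (rule id_take_nth_drop[OF assms(2)])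
  have "I ! k \<notin> set (L @ M)" using assms(1) by (subst (asm) I) simp
  moreover have "set I = insert (I ! k) (set (L @ M))" by (subst I) simp
  ultimately show ?thesis unfolding L_def[symmetric] M_def[symmetric] by auto
qed

text \<open>
  Dual to deconcatenation: the function \<open>\<phi>\<close> of two words is evaluated on all cuts of \<open>w\<close> whose
  first part is nonempty.
\<close>

definition cut_sum :: "('a list \<Rightarrow> 'a list \<Rightarrow> 'c::ab_group_add) \<Rightarrow> 'a list \<Rightarrow> 'c" where
  "cut_sum \<phi> w = (\<Sum>i<length w. \<phi> (take (Suc i) w) (drop (Suc i) w))"

text \<open>
  Dual to the Alexander--Whitney coproduct: the two parts share the vertex at which the face is cut.
\<close>

definition face_cut_sum :: "('a list \<Rightarrow> 'a list \<Rightarrow> 'c::ab_group_add) \<Rightarrow> 'a list \<Rightarrow> 'c" where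
  "face_cut_sum \<phi> I = (\<Sum>i<length I. \<phi> (take (Suc i) I) (drop i I))"

text \<open>
  The augmented simplicial boundary, defined on every list of vertices. On functions that vanish on the
  empty face it agrees with the convention that a vertex has no boundary.
\<close>

definition boundary_sum :: "('a list \<Rightarrow> 'c::ab_group_add) \<Rightarrow> 'a list \<Rightarrow> 'c" where
  "boundary_sum \<phi> I = (\<Sum>i<length I. signed (int i) (\<phi> (omit i I)))"

lemma cut_sum_simps [simp]:
  "cut_sum \<phi> [] = 0"
  "cut_sum \<phi> (z # w) = \<phi> [z] w + cut_sum (\<lambda>u. \<phi> (z # u)) w"
  by (simp_all add: cut_sum_def sum.lessThan_Suc_shift del: sum.lessThan_Suc)

lemma face_cut_sum_simps [simp]:
  "face_cut_sum \<phi> [] = 0"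
  "face_cut_sum \<phi> (v # I) = \<phi> [v] (v # I) + face_cut_sum (\<lambda>J. \<phi> (v # J)) I"
  by (simp_all add: face_cut_sum_def sum.lessThan_Suc_shift del: sum.lessThan_Suc)

lemma signed_Suc: "signed (int (Suc i)) x = - signed (int i) x"
  by (simp add: signed_def)

lemma boundary_sum_simps [simp]:
  "boundary_sum \<phi> [] = 0"
  "boundary_sum \<phi> (v # I) = \<phi> I - boundary_sum (\<lambda>J. \<phi> (v # J)) I"
  by (simp_all add: boundary_sum_def sum.lessThan_Suc_shift signed_Suc sum_negf del: sum.lessThan_Suc of_nat_Suc)

lemma cut_sum_cong [fundef_cong]:
  assumes "w = w'" "\<And>u v. u @ v = w' \<Longrightarrow> u \<noteq> [] \<Longrightarrow> \<phi> u v = \<psi> u v"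
  shows "cut_sum \<phi> w = cut_sum \<psi> w'"
  unfolding cut_sum_def assms(1)
  by (intro sum.cong refl assms(2)) auto

lemma face_cut_sum_cong [fundef_cong]:
  assumes "I = I'"
    and "\<And>J K i. i < length I' \<Longrightarrow> J = take (Suc i) I' \<Longrightarrow> K = drop i I' \<Longrightarrow> \<phi> J K = \<psi> J K"
  shows "face_cut_sum \<phi> I = face_cut_sum \<psi> I'"
  unfolding face_cut_sum_def assms(1)
  by (intro sum.cong refl assms(2)) auto

lemma cut_sum_add: "cut_sum (\<lambda>u v. \<phi> u v + \<psi> u v) w = cut_sum \<phi> w + cut_sum \<psi> w"
  by (simp add: cut_sum_def sum.distrib)

lemma face_cut_sum_add:
  "face_cut_sum (\<lambda>u v. \<phi> u v + \<psi> u v) w = face_cut_sum \<phi> w + face_cut_sum \<psi> w"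
  by (simp add: face_cut_sum_def sum.distrib)

lemma boundary_sum_add: "boundary_sum (\<lambda>u. \<phi> u + \<psi> u) w = boundary_sum \<phi> w + boundary_sum \<psi> w"
  by (simp add: boundary_sum_def sum.distrib signed_add)

lemma boundary_sum_minus: "boundary_sum (\<lambda>u. - \<phi> u) w = - boundary_sum \<phi> w"
  by (simp add: boundary_sum_def sum_negf signed_minus)

lemma boundary_sum_diff: "boundary_sum (\<lambda>u. \<phi> u - \<psi> u) w = boundary_sum \<phi> w - boundary_sum \<psi> w"
  by (simp add: boundary_sum_def sum_subtractf signed_diff)

lemma additive_signed: "additive (signed e)"
  by (simp add: additive_def signed_add)

lemma additive_cut_sum: "additive G \<Longrightarrow> G (cut_sum \<phi> w) = cut_sum (\<lambda>u v. G (\<phi> u v)) w"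
  by (simp add: cut_sum_def additive.sum)

lemma additive_face_cut_sum:
  "additive G \<Longrightarrow> G (face_cut_sum \<phi> w) = face_cut_sum (\<lambda>u v. G (\<phi> u v)) w"
  by (simp add: face_cut_sum_def additive.sum)

lemma additive_boundary_sum: "additive G \<Longrightarrow> G (boundary_sum \<phi> w) = boundary_sum (\<lambda>u. G (\<phi> u)) w"
  by (auto simp: boundary_sum_def additive.sum signed_def additive.minus intro!: sum.cong)

lemma cut_sum_append:
  "cut_sum \<psi> (u @ v) = cut_sum (\<lambda>u1 u2. \<psi> u1 (u2 @ v)) u + cut_sum (\<lambda>v1. \<psi> (u @ v1)) v"
  by (induction u arbitrary: \<psi>) simp_all

text \<open>
  Coassociativity. The middle part may be empty although the first one may not, which accounts for the
  term with \<open>[]\<close>.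
\<close>

lemma cut_sum_assoc:
  "cut_sum (\<lambda>u v. cut_sum (\<lambda>u1 u2. \<phi> u1 u2 v) u) w
   = cut_sum (\<lambda>u v. \<phi> u [] v + cut_sum (\<lambda>v1. \<phi> u v1) v) w"
  by (induction w arbitrary: \<phi>) (simp_all add: cut_sum_add algebra_simps)

lemma face_cut_sum_assoc:
  "face_cut_sum (\<lambda>J K. face_cut_sum (\<lambda>J1 J2. \<phi> J1 J2 K) J) I
   = face_cut_sum (\<lambda>J K. face_cut_sum (\<lambda>K1. \<phi> J K1) K) I"
  by (induction I arbitrary: \<phi>) (simp_all add: face_cut_sum_add algebra_simps)

lemma boundary_sum_boundary_sum: "boundary_sum (boundary_sum \<phi>) I = 0"
  by (induction I arbitrary: \<phi>) (simp_all add: boundary_sum_diff boundary_sum_minus)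

lemma face_cut_sum_diff:
  "face_cut_sum (\<lambda>u v. \<phi> u v - \<psi> u v) w = face_cut_sum \<phi> w - face_cut_sum \<psi> w"
  by (simp add: face_cut_sum_def sum_subtractf)

lemma face_cut_sum_minus: "face_cut_sum (\<lambda>u v. - \<phi> u v) w = - face_cut_sum \<phi> w"
  by (simp add: face_cut_sum_def sum_negf)

text \<open>
  The coproduct is a chain map. Removing the shared vertex of one cut from the first part, and removing the
  shared vertex of the preceding cut from the second part, give the same pair with opposite signs. These
  terms telescope; what is left at the two ends are the terms with an empty face.
\<close>

lemma boundary_sum_face_cut_sum:
  fixes \<phi> :: "'a list \<Rightarrow> 'a list \<Rightarrow> 'b::ab_group_add"
  shows "boundary_sum (face_cut_sum \<phi>) I =
     face_cut_sum (\<lambda>J K. boundary_sum (\<lambda>J. \<phi> J K) J + signed (int (length J) - 1) (boundary_sum (\<phi> J) K)) I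
     - \<phi> [] I + signed (int (length I)) (\<phi> I [])"
proof (induction I arbitrary: \<phi>)
  case (Cons v I)
  have sgn: "signed (int (length J)) x = - signed (int (length J) - 1) x" for J :: "'a list" and x :: 'b
    by (rule signed_odd) simp
  have sgn': "signed (1 + int (length J)) x = - signed (int (length J)) x" for J :: "'a list" and x :: 'b
    by (rule signed_odd) simp
  show ?case
    by (simp add: Cons.IH boundary_sum_add boundary_sum_diff face_cut_sum_add face_cut_sum_diff face_cut_sum_minus sgn sgn')
qed simp


section \<open>The bar differential\<close>

text \<open>
  Precomposition of \<open>\<phi>\<close> with the coderivation of the tensor coalgebra that has the components \<open>b\<close>,
  of degree 1. The recursion separates the insertions that involve the first letter from the others,
  which have to pass it.
\<close>

fun codiff :: "('a::ab_group_add word \<Rightarrow> 'a) \<Rightarrow> ('a word \<Rightarrow> 'c::ab_group_add) \<Rightarrow> 'a word \<Rightarrow> 'c" where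
  "codiff b \<phi> [] = 0"
| "codiff b \<phi> (z # w) = cut_sum (\<lambda>u v. \<phi> ((deg u + 1, b u) # v)) (z # w)
     + signed (fst z) (codiff b (\<lambda>w'. \<phi> (z # w')) w)"

declare codiff.simps(2) [simp del]

lemma codiff_cong:
  assumes "\<And>u v t. u @ v @ t = w \<Longrightarrow> v \<noteq> [] \<Longrightarrow>
    \<phi> (u @ (deg v + 1, b v) # t) = \<psi> (u @ (deg v + 1, b v) # t)"
  shows "codiff b \<phi> w = codiff b \<psi> w"
  using assms
proof (induction w arbitrary: \<phi> \<psi>)
  case (Cons z w)
  have "codiff b (\<lambda>w'. \<phi> (z # w')) w = codiff b (\<lambda>w'. \<psi> (z # w')) w"
  proof (rule Cons.IH)
    fix u v t :: "'a word"
    assume "u @ v @ t = w" "v \<noteq> []"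
    then show "\<phi> (z # u @ (deg v + 1, b v) # t) = \<psi> (z # u @ (deg v + 1, b v) # t)"
      using Cons.prems[of "z # u" v t] by simp
  qed
  moreover have "cut_sum (\<lambda>u v. \<phi> ((deg u + 1, b u) # v)) (z # w)
      = cut_sum (\<lambda>u v. \<psi> ((deg u + 1, b u) # v)) (z # w)"
  proof (rule cut_sum_cong[OF refl])
    fix u v assume "u @ v = z # w" "u \<noteq> []"
    then show "\<phi> ((deg u + 1, b u) # v) = \<psi> ((deg u + 1, b u) # v)"
      using Cons.prems[of "[]" u v] by simp
  qed
  ultimately show ?case by (simp only: codiff.simps)
qed simp

lemma codiff_cong_deg:
  assumes "\<And>w'. w' \<noteq> [] \<Longrightarrow> deg w' = deg w + 1 \<Longrightarrow> \<phi> w' = \<psi> w'"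
  shows "codiff b \<phi> w = codiff b \<psi> w"
  by (rule codiff_cong, rule assms) auto

lemma codiff_add: "codiff b (\<lambda>w. \<phi> w + \<psi> w) w = codiff b \<phi> w + codiff b \<psi> w"
  by (induction w arbitrary: \<phi> \<psi>) (simp_all add: codiff.simps cut_sum_add signed_add algebra_simps)

lemma additive_codiff:
  assumes "additive G"
  shows "G (codiff b \<phi> w) = codiff b (\<lambda>w. G (\<phi> w)) w"
proof (induction w arbitrary: \<phi>)
  case Nil
  show ?case using additive.zero[OF assms] by simp
next
  case (Cons z w)
  have s: "G (signed e x) = signed e (G x)" for e x
    by (simp add: signed_def additive.minus[OF assms])
  show ?case
    unfolding codiff.simps additive.add[OF assms] additive_cut_sum[OF assms] s Cons.IH ..
qed

lemma codiff_zero: "codiff b (\<lambda>w. 0) w = 0"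
  by (induction w) (simp_all add: codiff.simps cut_sum_def)

lemma codiff_signed: "codiff b (\<lambda>w. signed e (\<phi> w)) w = signed e (codiff b \<phi> w)"
  by (simp add: additive_codiff[OF additive_signed])

lemma codiff_signed_deg:
  "codiff b (\<lambda>w. signed (c * deg w) (\<phi> w)) w = signed (c * deg w + c) (codiff b \<phi> w)"
  unfolding codiff_signed[symmetric]
  by (rule codiff_cong_deg) (simp add: algebra_simps)

lemma codiff_sum: "codiff b (\<lambda>w. \<Sum>i\<in>S. \<phi> i w) w = (\<Sum>i\<in>S. codiff b (\<phi> i) w)"
  by (induction S rule: infinite_finite_induct) (simp_all add: codiff_zero codiff_add)

lemma codiff_minus: "codiff b (\<lambda>w. - \<phi> w) w = - codiff b \<phi> w"
  using additive_codiff[of uminus b \<phi> w] by (simp add: additive_def)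

lemma codiff_diff: "codiff b (\<lambda>w. \<phi> w - \<psi> w) w = codiff b \<phi> w - codiff b \<psi> w"
  using codiff_add[of b \<phi> "\<lambda>w. - \<psi> w" w] by (simp add: codiff_minus)

text \<open>
  The coderivation property with respect to deconcatenation: an operation applied to consecutive letters
  lies on one side of every cut of the result.
\<close>

lemma codiff_cut_sum:
  "codiff b (cut_sum \<psi>) w =
     cut_sum (\<lambda>u v. codiff b (\<lambda>u. \<psi> u v) u + signed (deg u) (codiff b (\<psi> u) v)) w"
proof (induction w arbitrary: \<psi>)
  case (Cons z w)
  let ?l = "\<lambda>u. (deg u + 1, b u)"
  have "cut_sum (\<lambda>u v. cut_sum (\<lambda>u1 u2. \<psi> (?l u1 # u2) v) u) (z # w)
      = cut_sum (\<lambda>u v. cut_sum \<psi> (?l u # v)) (z # w)"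
    by (simp only: cut_sum_assoc cut_sum_simps)
  then show ?case
    by (simp add: codiff.simps Cons.IH codiff_add cut_sum_add signed_add signed_signed
        additive_cut_sum[OF additive_signed] algebra_simps)
qed simp

text \<open>
  Operations on disjoint groups of letters cancel by the sign rule, and nested operations give the
  \<open>A\<^sub>\<infinity>\<close>-relation. In the induction the disjoint ones are handled by the coderivation property.
\<close>

lemma codiff_codiff:
  assumes "multiadditive \<phi>"
    and "\<And>u v t. u @ v @ t = w \<Longrightarrow> codiff b b v = 0"
  shows "codiff b (codiff b \<phi>) w = 0"
  using assms
proof (induction w arbitrary: \<phi>)
  case (Cons z w)
  let ?l = "\<lambda>u. (deg u + 1, b u)"
  let ?h = "\<lambda>u v. \<phi> (?l u # v)"
  have IH: "codiff b (codiff b (\<lambda>w. \<phi> (z # w))) w = 0"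
  proof (rule Cons.IH)
    show "multiadditive (\<lambda>w. \<phi> (z # w))" using Cons.prems(1) by (rule multiadditive_Cons)
    show "codiff b b v = 0" if "u @ v @ t = w" for u v t
      using Cons.prems(2)[of "z # u" v t] that by simp
  qed
  have inner: "cut_sum (\<lambda>u v. codiff b (\<lambda>u. ?h u v) u) (z # w) = 0"
  proof -
    have "codiff b (\<lambda>u. ?h u v) u = 0" if "u @ v = z # w" for u v
    proof -
      have "codiff b (\<lambda>u. ?h u v) u = codiff b (\<lambda>u'. \<phi> ((deg u + 2, b u') # v)) u"
        by (rule codiff_cong_deg) (simp add: add.commute)
      also have "\<dots> = \<phi> ((deg u + 2, codiff b b u) # v)"
        using additive_codiff[OF multiadditive_additive[OF Cons.prems(1), of "[]" "deg u + 2" v], of b b u] by simp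
      also have "codiff b b u = 0"
        using Cons.prems(2)[of "[]" u v] that by simp
      also have "\<phi> ((deg u + 2, 0) # v) = 0"
        using additive.zero[OF multiadditive_additive[OF Cons.prems(1), of "[]" _ v]] by simp
      finally show ?thesis .
    qed
    then have "cut_sum (\<lambda>u v. codiff b (\<lambda>u. ?h u v) u) (z # w) = cut_sum (\<lambda>u v. 0) (z # w)"
      by (intro cut_sum_cong) auto
    then show ?thesis by (simp only: cut_sum_def) simp
  qed
  have "codiff b (codiff b \<phi>) (z # w) =
      cut_sum (\<lambda>u v. cut_sum ?h (?l u # v) + signed (deg u + 1) (codiff b (?h u) v)) (z # w)
      + signed (fst z) (codiff b (\<lambda>w. cut_sum ?h (z # w)
            + signed (fst z) (codiff b (\<lambda>w. \<phi> (z # w)) w)) w)"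
    by (simp only: codiff.simps fst_conv)
  also have "\<dots> = codiff b (cut_sum ?h) (z # w)
      + cut_sum (\<lambda>u v. signed (deg u + 1) (codiff b (?h u) v)) (z # w)"
    by (simp only: codiff_add cut_sum_add codiff_signed IH codiff.simps signed_0 signed_add add_0_right add_0_left ac_simps)
  also have "\<dots> = cut_sum (\<lambda>u v. codiff b (\<lambda>u. ?h u v) u) (z # w)
     + cut_sum (\<lambda>u v. signed (deg u) (codiff b (?h u) v) + signed (deg u + 1) (codiff b (?h u) v)) (z # w)"
    by (simp only: codiff_cut_sum cut_sum_add ac_simps)
  also have "\<dots> = 0"
  proof -
    have "signed (e + 1) x = - signed e x" for e and x :: 'b
      by (rule signed_odd) simp
    then show ?thesis by (simp only: inner) (simp add: cut_sum_def)
  qed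
  finally show ?case .
qed simp


section \<open>The dg-coalgebra of faces and words\<close>

text \<open>
  The dimension of a face. The empty list has dimension \<open>-1\<close>, in accordance with the augmented boundary.
\<close>

abbreviation "ldim I \<equiv> int (length I) - 1"

text \<open>
  Precomposition with the differential of the tensor product of the simplex and the bar construction.
  Moving the bar differential past a face of degree \<open>- ldim I\<close> costs the sign.
\<close>

definition total_codiff ::
  "('a::ab_group_add word \<Rightarrow> 'a) \<Rightarrow> (nat list \<Rightarrow> 'a word \<Rightarrow> 'c::ab_group_add) \<Rightarrow> nat list \<Rightarrow> 'a word \<Rightarrow> 'c"
  where "total_codiff b \<phi> I w = boundary_sum (\<lambda>J. \<phi> J w) I + signed (ldim I) (codiff b (\<phi> I) w)"

text \<open>
  The coproduct of the tensor product: the second face, of degree \<open>- ldim K\<close>, is moved past the word \<open>u\<close>.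
\<close>

definition coproduct ::
  "(nat list \<Rightarrow> 'a word \<Rightarrow> nat list \<Rightarrow> 'a word \<Rightarrow> 'c::ab_group_add) \<Rightarrow> nat list \<Rightarrow> 'a word \<Rightarrow> 'c" where
  "coproduct \<phi> I w =
     face_cut_sum (\<lambda>J K. cut_sum (\<lambda>u v. signed (ldim K * deg u) (\<phi> J u K v)) w) I"

lemma cut_sum_face_cut_sum:
  "cut_sum (\<lambda>u v. face_cut_sum (\<lambda>J K. \<psi> u v J K) I) w
   = face_cut_sum (\<lambda>J K. cut_sum (\<lambda>u v. \<psi> u v J K) w) I"
  unfolding cut_sum_def face_cut_sum_def by (rule sum.swap)

lemma boundary_sum_cut_sum: "boundary_sum (\<lambda>J. cut_sum (\<lambda>u v. \<psi> u v J) w) I = cut_sum (\<lambda>u v. boundary_sum (\<psi> u v) I) w"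
  unfolding cut_sum_def boundary_sum_def signed_sum by (rule sum.swap)

lemma boundary_sum_codiff: "boundary_sum (\<lambda>J. codiff b (\<phi> J) w) I = codiff b (\<lambda>w. boundary_sum (\<lambda>J. \<phi> J w) I) w"
  unfolding boundary_sum_def codiff_sum codiff_signed ..

lemma boundary_sum_cong_length:
  assumes "\<And>J. length J + 1 = length I \<Longrightarrow> \<phi> J = \<psi> J"
  shows "boundary_sum \<phi> I = boundary_sum \<psi> I"
  unfolding boundary_sum_def using assms by (intro sum.cong) auto

lemma boundary_sum_signed: "boundary_sum (\<lambda>J. signed e (\<phi> J)) I = signed e (boundary_sum \<phi> I)"
  by (simp add: additive_boundary_sum[OF additive_signed])

text \<open>
  The mixed terms cancel because the boundary lowers the dimension of the face by one.
\<close>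

lemma total_codiff_total_codiff:
  assumes "\<And>J. multiadditive (\<phi> J)"
    and "\<And>u v t. u @ v @ t = w \<Longrightarrow> codiff b b v = 0"
  shows "total_codiff b (total_codiff b \<phi>) I w = 0"
proof -
  have "boundary_sum (\<lambda>J. signed (ldim J) (codiff b (\<phi> J) w)) I = boundary_sum (\<lambda>J. - signed (ldim I) (codiff b (\<phi> J) w)) I"
    by (rule boundary_sum_cong_length, rule signed_odd) presburger
  also have "\<dots> = - signed (ldim I) (codiff b (\<lambda>w. boundary_sum (\<lambda>J. \<phi> J w) I) w)"
    by (simp only: boundary_sum_minus boundary_sum_signed boundary_sum_codiff)
  finally show ?thesis
    using codiff_codiff[OF assms]
    by (simp add: total_codiff_def[abs_def] boundary_sum_add boundary_sum_boundary_sum codiff_add codiff_signed signed_add)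
qed

lemma codiff_face_cut_sum:
  "codiff b (\<lambda>w. face_cut_sum (\<lambda>J K. \<phi> J K w) I) w = face_cut_sum (\<lambda>J K. codiff b (\<phi> J K) w) I"
  unfolding face_cut_sum_def codiff_sum ..

text \<open>
  The differential is a coderivation of the tensor product coalgebra. The hypotheses discard the two
  boundary terms with an empty face.
\<close>

lemma total_codiff_coproduct:
  assumes 1: "\<And>u K v. \<phi> [] u K v = 0" and 2: "\<And>J u v. \<phi> J u [] v = 0"
  shows "total_codiff b (coproduct \<phi>) I w =
    coproduct (\<lambda>J u K v. total_codiff b (\<lambda>J u. \<phi> J u K v) J u
       + signed (deg u - ldim J) (total_codiff b (\<phi> J u) K v)) I w"
proof -
  have A: "boundary_sum (\<lambda>I. coproduct \<phi> I w) I =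
      face_cut_sum (\<lambda>J K. cut_sum (\<lambda>u v. signed (ldim K * deg u) (boundary_sum (\<lambda>J. \<phi> J u K v) J
       + signed (deg u - ldim J) (boundary_sum (\<lambda>K. \<phi> J u K v) K))) w) I"
  proof -
    have "boundary_sum (\<lambda>I. coproduct \<phi> I w) I =
       cut_sum (\<lambda>u v. boundary_sum (face_cut_sum (\<lambda>J K. signed (ldim K * deg u) (\<phi> J u K v))) I) w"
      unfolding coproduct_def cut_sum_face_cut_sum[symmetric] boundary_sum_cut_sum ..
    also have "\<dots> = cut_sum (\<lambda>u v. face_cut_sum (\<lambda>J K.
        signed (ldim K * deg u) (boundary_sum (\<lambda>J. \<phi> J u K v) J
       + signed (deg u - ldim J) (boundary_sum (\<lambda>K. \<phi> J u K v) K))) I) w"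
    proof (intro cut_sum_cong refl)
      fix u v
      have s: "signed (ldim J) (boundary_sum (\<lambda>K. signed (ldim K * deg u) (\<phi> J u K v)) K)
          = signed (ldim K * deg u) (signed (deg u - ldim J) (boundary_sum (\<lambda>K. \<phi> J u K v) K))" for J K
      proof -
        have "boundary_sum (\<lambda>K. signed (ldim K * deg u) (\<phi> J u K v)) K
            = boundary_sum (\<lambda>L. signed ((ldim K - 1) * deg u) (\<phi> J u L v)) K"
        proof (rule boundary_sum_cong_length)
          fix L :: "nat list" assume "length L + 1 = length K"
          then have "ldim L = ldim K - 1" by linarith
          then show "signed (ldim L * deg u) (\<phi> J u L v) = signed ((ldim K - 1) * deg u) (\<phi> J u L v)"
            by (simp only:)
        qed
        then show ?thesis
          unfolding boundary_sum_signed signed_signed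
          by (simp only: boundary_sum_signed signed_signed) (rule signed_parity, simp add: algebra_simps)
      qed
      show "boundary_sum (face_cut_sum (\<lambda>J K. signed (ldim K * deg u) (\<phi> J u K v))) I
        = face_cut_sum (\<lambda>J K. signed (ldim K * deg u) (boundary_sum (\<lambda>J. \<phi> J u K v) J
          + signed (deg u - ldim J) (boundary_sum (\<lambda>K. \<phi> J u K v) K))) I"
        unfolding boundary_sum_face_cut_sum s by (simp add: 1 2 boundary_sum_signed signed_add)
    qed
    finally show ?thesis by (simp only: cut_sum_face_cut_sum)
  qed
  have B: "signed (ldim I) (codiff b (coproduct \<phi> I) w) =
      face_cut_sum (\<lambda>J K. cut_sum (\<lambda>u v. signed (ldim K * deg u) (signed (ldim J) (codiff b (\<lambda>u. \<phi> J u K v) u)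
       + signed (deg u - ldim J) (signed (ldim K) (codiff b (\<phi> J u K) v)))) w) I"
  proof -
    have "signed (ldim I) (codiff b (coproduct \<phi> I) w) =
       face_cut_sum (\<lambda>J K. signed (ldim I) (codiff b
          (cut_sum (\<lambda>u v. signed (ldim K * deg u) (\<phi> J u K v))) w)) I"
      unfolding coproduct_def[abs_def] codiff_face_cut_sum additive_face_cut_sum[OF additive_signed] ..
    also have "\<dots> = face_cut_sum (\<lambda>J K. cut_sum (\<lambda>u v. signed (ldim K * deg u)
        (signed (ldim J) (codiff b (\<lambda>u. \<phi> J u K v) u)
       + signed (deg u - ldim J) (signed (ldim K) (codiff b (\<phi> J u K) v)))) w) I"
    proof (rule face_cut_sum_cong[OF refl])
      fix J K i assume "i < length I" and JK: "J = take (Suc i) I" "K = drop i I"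
      then have ldim: "ldim I = ldim J + ldim K" by simp
      show "signed (ldim I) (codiff b (cut_sum (\<lambda>u v. signed (ldim K * deg u) (\<phi> J u K v))) w)
        = cut_sum (\<lambda>u v. signed (ldim K * deg u) (signed (ldim J) (codiff b (\<lambda>u. \<phi> J u K v) u)
           + signed (deg u - ldim J) (signed (ldim K) (codiff b (\<phi> J u K) v)))) w"
        unfolding codiff_cut_sum codiff_signed_deg codiff_signed additive_cut_sum[OF additive_signed]
          signed_add signed_signed ldim
        by (intro cut_sum_cong refl arg_cong2[where f = "(+)"] signed_parity) (auto simp: algebra_simps)
    qed
    finally show ?thesis .
  qed
  show ?thesis
    unfolding total_codiff_def A B coproduct_def[of "\<lambda>J u K v. _ J u K v + _ J u K v"]
    by (simp only: coproduct_def face_cut_sum_add[symmetric] cut_sum_add[symmetric] signed_add ac_simps)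
qed

lemma coproduct_cong [fundef_cong]:
  assumes "I = I'" "w = w'"
    and "\<And>J u K v i. i < length I' \<Longrightarrow> J = take (Suc i) I' \<Longrightarrow> K = drop i I' \<Longrightarrow>
      u @ v = w' \<Longrightarrow> u \<noteq> [] \<Longrightarrow> \<phi> J u K v = \<psi> J u K v"
  shows "coproduct \<phi> I w = coproduct \<psi> I' w'"
  unfolding coproduct_def assms(1,2)
  by (intro face_cut_sum_cong cut_sum_cong refl arg_cong[where f = "signed _"] assms(3))

lemma coproduct_add:
  "coproduct (\<lambda>J u K v. \<phi> J u K v + \<psi> J u K v) I w = coproduct \<phi> I w + coproduct \<psi> I w"
  by (simp add: coproduct_def face_cut_sum_add cut_sum_add signed_add)

lemma additive_coproduct:
  "additive G \<Longrightarrow> G (coproduct \<phi> I w) = coproduct (\<lambda>J u K v. G (\<phi> J u K v)) I w"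
  unfolding coproduct_def additive_face_cut_sum additive_cut_sum
  by (intro face_cut_sum_cong cut_sum_cong refl) (auto simp: signed_def additive.minus)

lemma coproduct_zero: "coproduct (\<lambda>J u K v. 0) I w = 0"
  by (simp add: coproduct_def face_cut_sum_def cut_sum_def)

lemma coproduct_Nil [simp]: "coproduct \<phi> [] w = 0" "coproduct \<phi> I [] = 0"
  by (simp_all add: coproduct_def face_cut_sum_def)


section \<open>Lifting a map to a coalgebra morphism\<close>

text \<open>
  The value of \<open>g\<close> on the image of the pair \<open>(I, w)\<close> under the coalgebra morphism with components \<open>F\<close>.
  Pairs with an empty word are mapped by the counit of the simplex, which is 1 on vertices. The output
  letter \<open>F J u\<close> has the degree of \<open>u\<close> minus the dimension of \<open>J\<close>.
\<close>

function lift ::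
  "(nat list \<Rightarrow> 'a word \<Rightarrow> 'b) \<Rightarrow> ('b word \<Rightarrow> 'c::ab_group_add) \<Rightarrow> nat list \<Rightarrow> 'a word \<Rightarrow> 'c" where
  "lift F g I [] = (if length I = 1 then g [] else 0)"
| "lift F g I (z # w) = coproduct (\<lambda>J u K v. lift F (\<lambda>ys. g ((deg u - ldim J, F J u) # ys)) K v) I (z # w)"
  by pat_completeness auto
termination
proof (relation "measure (\<lambda>(F, g, I, w). length w)"; clarsimp)
  fix z :: "int \<times> 'a" and w u v assume "u @ v = z # w" "u \<noteq> []"
  then have "length u + length v = Suc (length w)" "length u \<noteq> 0"
    by (metis length_append length_Cons, simp)
  then show "length v < Suc (length w)" by linarith
qed

declare lift.simps(2) [simp del]

lemma lift_Nil_face [simp]: "lift F g [] w = 0"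
  by (cases w) (simp_all add: lift.simps)

lemma lift_coproduct:
  assumes "w \<noteq> []"
  shows "lift F g I w = coproduct (\<lambda>J u K v. lift F (\<lambda>ys. g ((deg u - ldim J, F J u) # ys)) K v) I w"
proof (cases w)
  case (Cons z w')
  show ?thesis unfolding Cons lift.simps ..
qed (use assms in simp)

lemma cut_length: "u @ v = w \<Longrightarrow> u \<noteq> [] \<Longrightarrow> length v < length w"
  by auto

text \<open>
  All output words have the degree of the pair \<open>(I, w)\<close>, and only empty words produce the empty word.
\<close>

lemma lift_cong:
  fixes F :: "nat list \<Rightarrow> 'a word \<Rightarrow> 'b"
  assumes "\<And>ys. deg ys = deg w - ldim I \<Longrightarrow> (ys = [] \<Longrightarrow> w = []) \<Longrightarrow> g ys = h ys"
  shows "lift F g I w = lift F h I w"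
  using assms
proof (induction w arbitrary: g h I rule: length_induct)
  case (1 w)
  show ?case
  proof (cases "w = []")
    case True
    then show ?thesis using "1.prems"[of "[]"] by simp
  next
    case False
    show ?thesis
      unfolding lift_coproduct[OF False]
    proof (intro coproduct_cong refl)
      fix J u K v i
      assume i: "i < length I" "J = take (Suc i) I" "K = drop i I" "u @ v = w" "u \<noteq> []"
      then have ldim: "deg w - ldim I = (deg u - ldim J) + (deg v - ldim K)" by auto
      show "lift F (\<lambda>ys. g ((deg u - ldim J, F J u) # ys)) K v
        = lift F (\<lambda>ys. h ((deg u - ldim J, F J u) # ys)) K v"
      proof (rule "1.IH"[rule_format])
        show "length v < length w" using i by auto
        fix ys :: "'b word" assume "deg ys = deg v - ldim K"
        then show "g ((deg u - ldim J, F J u) # ys) = h ((deg u - ldim J, F J u) # ys)"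
          by (intro "1.prems") (simp_all only: ldim deg_simps fst_conv list.distinct)
      qed
    qed
  qed
qed

lemma lift_add: "lift F (\<lambda>ys. g ys + h ys) I w = lift F g I w + lift F h I w"
proof (induction w arbitrary: g h I rule: length_induct)
  case (1 w)
  show ?case
  proof (cases "w = []")
    case False
    have "coproduct (\<lambda>J u K v. lift F (\<lambda>ys. g ((deg u - ldim J, F J u) # ys) + h ((deg u - ldim J, F J u) # ys)) K v) I w
        = coproduct (\<lambda>J u K v. lift F (\<lambda>ys. g ((deg u - ldim J, F J u) # ys)) K v
            + lift F (\<lambda>ys. h ((deg u - ldim J, F J u) # ys)) K v) I w"
      by (intro coproduct_cong refl "1.IH"[rule_format] cut_length)
    with False show ?thesis by (simp add: lift_coproduct coproduct_add)
  qed simp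
qed

lemma additive_lift:
  assumes "additive G"
  shows "G (lift F g I w) = lift F (\<lambda>ys. G (g ys)) I w"
proof (induction w arbitrary: g I rule: length_induct)
  case (1 w)
  show ?case
  proof (cases "w = []")
    case False
    have "G (lift F g I w) = coproduct (\<lambda>J u K v. G (lift F (\<lambda>ys. g ((deg u - ldim J, F J u) # ys)) K v)) I w"
      unfolding lift_coproduct[OF False] additive_coproduct[OF assms] ..
    also have "\<dots> = coproduct (\<lambda>J u K v. lift F (\<lambda>ys. G (g ((deg u - ldim J, F J u) # ys))) K v) I w"
      by (intro coproduct_cong refl "1.IH"[rule_format] cut_length)
    finally show ?thesis by (simp only: lift_coproduct[OF False])
  qed (simp add: additive.zero[OF assms])
qed

lemma lift_signed: "lift F (\<lambda>ys. signed e (g ys)) I w = signed e (lift F g I w)"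
  by (simp add: additive_lift[OF additive_signed])

lemma lift_zero: "lift F (\<lambda>ys. 0) I w = 0"
  using lift_add[of F "\<lambda>_. 0" "\<lambda>_. 0" I w] by simp

lemma lift_sum: "lift F (\<lambda>ys. \<Sum>i\<in>S. g i ys) I w = (\<Sum>i\<in>S. lift F (g i) I w)"
  by (induction S rule: infinite_finite_induct) (simp_all add: lift_zero lift_add)

lemma lift_coproduct_swap:
  "lift F (\<lambda>ys. coproduct (\<lambda>J u K v. \<phi> J u K v ys) I' w') I w
   = coproduct (\<lambda>J u K v. lift F (\<phi> J u K v) I w) I' w'"
  unfolding coproduct_def face_cut_sum_def cut_sum_def lift_sum lift_signed ..

lemma additive_slot:
  assumes "multiadditive g"
  shows "additive (\<lambda>x. lift F (\<lambda>ys. g ((p, x) # ys)) K v)"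
  by (simp add: additive_def lift_add[symmetric] multiadditiveD[OF assms, of "[]", simplified])

text \<open>
  The argument of the slot has constant degree, so additivity lets the sum move inside the slot.
\<close>

lemma lift_slot:
  assumes "multiadditive g"
  shows "lift F (\<lambda>u. g ((deg u + 1, f u) # ys)) I w = g ((deg w - ldim I + 1, lift F f I w) # ys)"
proof -
  have "lift F (\<lambda>u. g ((deg u + 1, f u) # ys)) I w = lift F (\<lambda>u. g ((deg w - ldim I + 1, f u) # ys)) I w"
    by (rule lift_cong) (simp only:)
  then show ?thesis
    using additive_lift[OF multiadditive_additive[OF assms, of "[]" "deg w - ldim I + 1" ys], of F f I w]
    by simp
qed

text \<open>
  The coderivation along the lift of \<open>F\<close> with components \<open>R\<close> of degree 1: in each summand one output
  letter \<open>F J u\<close> is replaced by \<open>R J u\<close>, which has to pass the letters before it.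
\<close>

function lift_insert ::
  "(nat list \<Rightarrow> 'a word \<Rightarrow> 'b) \<Rightarrow> (nat list \<Rightarrow> 'a word \<Rightarrow> 'b) \<Rightarrow> ('b word \<Rightarrow> 'c::ab_group_add) \<Rightarrow>
    nat list \<Rightarrow> 'a word \<Rightarrow> 'c" where
  "lift_insert F R g I [] = 0"
| "lift_insert F R g I (z # w) = coproduct (\<lambda>J u K v.
       lift F (\<lambda>ys. g ((deg u - ldim J + 1, R J u) # ys)) K v
       + signed (deg u - ldim J) (lift_insert F R (\<lambda>ys. g ((deg u - ldim J, F J u) # ys)) K v)) I (z # w)"
  by pat_completeness auto
termination
proof (relation "measure (\<lambda>(F, R, g, I, w). length w)"; clarsimp)
  fix z :: "int \<times> 'a" and w u v assume "u @ v = z # w" "u \<noteq> []"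
  then have "length u + length v = Suc (length w)" "length u \<noteq> 0"
    by (metis length_append length_Cons, simp)
  then show "length v < Suc (length w)" by linarith
qed

declare lift_insert.simps(2) [simp del]

lemma lift_insert_coproduct:
  "lift_insert F R g I w = coproduct (\<lambda>J u K v.
       lift F (\<lambda>ys. g ((deg u - ldim J + 1, R J u) # ys)) K v
       + signed (deg u - ldim J) (lift_insert F R (\<lambda>ys. g ((deg u - ldim J, F J u) # ys)) K v)) I w"
  by (cases w) (simp_all add: lift_insert.simps)

lemma lift_insert_diff:
  assumes "multiadditive g"
  shows "lift_insert F (\<lambda>J u. R J u - S J u) g I w = lift_insert F R g I w - lift_insert F S g I w"
  using assms
proof (induction w arbitrary: g I rule: length_induct)
  case (1 w)
  have "lift_insert F (\<lambda>J u. R J u - S J u) g I w + lift_insert F S g I w = lift_insert F R g I w"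
    unfolding lift_insert_coproduct[of F _ g] coproduct_add[symmetric]
  proof (intro coproduct_cong refl)
    fix J u K v assume "u @ v = w" "u \<noteq> []"
    then have "length v < length w" by (rule cut_length)
    with 1 have "lift_insert F (\<lambda>J u. R J u - S J u) (\<lambda>ys. g ((deg u - ldim J, F J u) # ys)) K v =
       lift_insert F R (\<lambda>ys. g ((deg u - ldim J, F J u) # ys)) K v
       - lift_insert F S (\<lambda>ys. g ((deg u - ldim J, F J u) # ys)) K v"
      by (blast intro: multiadditive_Cons)
    then show "lift F (\<lambda>ys. g ((deg u - ldim J + 1, R J u - S J u) # ys)) K v
       + signed (deg u - ldim J) (lift_insert F (\<lambda>J u. R J u - S J u) (\<lambda>ys. g ((deg u - ldim J, F J u) # ys)) K v)
       + (lift F (\<lambda>ys. g ((deg u - ldim J + 1, S J u) # ys)) K v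
       + signed (deg u - ldim J) (lift_insert F S (\<lambda>ys. g ((deg u - ldim J, F J u) # ys)) K v))
       = lift F (\<lambda>ys. g ((deg u - ldim J + 1, R J u) # ys)) K v
       + signed (deg u - ldim J) (lift_insert F R (\<lambda>ys. g ((deg u - ldim J, F J u) # ys)) K v)"
      by (simp add: additive.diff[OF additive_slot[OF "1.prems"]] signed_diff)
  qed
  then show ?case by (simp add: eq_diff_eq)
qed

lemma total_codiff_slot:
  assumes "\<And>p. additive (G p)"
  shows "total_codiff b (\<lambda>J u. G (deg u - ldim J) (\<phi> J u)) I w = G (deg w - ldim I + 1) (total_codiff b \<phi> I w)"
proof -
  have "boundary_sum (\<lambda>J. G (deg w - ldim J) (\<phi> J w)) I = boundary_sum (\<lambda>J. G (deg w - ldim I + 1) (\<phi> J w)) I"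
  proof (rule boundary_sum_cong_length)
    fix J :: "nat list" assume "length J + 1 = length I"
    then have "deg w - ldim J = deg w - ldim I + 1" by linarith
    then show "G (deg w - ldim J) (\<phi> J w) = G (deg w - ldim I + 1) (\<phi> J w)" by (simp only:)
  qed
  moreover have "codiff b (\<lambda>u. G (deg u - ldim I) (\<phi> I u)) w = codiff b (\<lambda>u. G (deg w - ldim I + 1) (\<phi> I u)) w"
    by (rule codiff_cong_deg) (simp add: algebra_simps)
  moreover have "G p (signed e x) = signed e (G p x)" for p e x
    by (simp add: signed_def additive.minus[OF assms])
  ultimately show ?thesis
    by (simp add: total_codiff_def additive.add[OF assms] additive_boundary_sum[OF assms] additive_codiff[OF assms])
qed

text \<open>
  Composing a coalgebra morphism with the differential of its source gives a coderivation along it, and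
  such a coderivation is determined by its components.
\<close>

lemma total_codiff_lift:
  assumes "multiadditive g" and F: "\<And>u. F [] u = 0"
  shows "total_codiff b (lift F g) I w = lift_insert F (total_codiff b F) g I w"
  using assms(1)
proof (induction w arbitrary: g I rule: length_induct)
  case (1 w)
  show ?case
  proof (cases "w = []")
    case True
    have "boundary_sum (\<lambda>J. if length J = 1 then g [] else 0) I = 0"
    proof (cases "length I = 2")
      case True
      then obtain a c where "I = [a, c]" by (auto simp: length_Suc_conv numeral_2_eq_2)
      then show ?thesis by simp
    next
      case False
      then have "boundary_sum (\<lambda>J. if length J = 1 then g [] else 0) I = boundary_sum (\<lambda>J. 0) I"
        by (intro boundary_sum_cong_length) auto
      then show ?thesis by (simp add: boundary_sum_def)
    qed
    then show ?thesis by (simp add: True total_codiff_def)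
  next
    case False
    let ?\<phi> = "\<lambda>J u K v. lift F (\<lambda>ys. g ((deg u - ldim J, F J u) # ys)) K v"
    have "total_codiff b (lift F g) I w = total_codiff b (coproduct ?\<phi>) I w"
    proof -
      have "codiff b (lift F g I) w = codiff b (coproduct ?\<phi> I) w"
        by (rule codiff_cong_deg) (simp add: lift_coproduct)
      then show ?thesis by (simp add: total_codiff_def lift_coproduct[OF False])
    qed
    also have "\<dots> = coproduct (\<lambda>J u K v. total_codiff b (\<lambda>J u. ?\<phi> J u K v) J u
       + signed (deg u - ldim J) (total_codiff b (?\<phi> J u) K v)) I w"
    proof (rule total_codiff_coproduct)
      show "?\<phi> [] u K v = 0" for u K v
        using additive.zero[OF additive_slot[OF "1.prems"]] by (simp add: F)
    qed simp
    also have "\<dots> = lift_insert F (total_codiff b F) g I w"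
      unfolding lift_insert_coproduct[of F _ g]
    proof (intro coproduct_cong refl arg_cong2[where f = "(+)"] arg_cong[where f = "signed _"])
      fix J u K v assume "u @ v = w" "u \<noteq> []"
      then have "length v < length w" by (rule cut_length)
      then show "total_codiff b (?\<phi> J u) K v
        = lift_insert F (total_codiff b F) (\<lambda>ys. g ((deg u - ldim J, F J u) # ys)) K v"
        using "1.IH" multiadditive_Cons[OF "1.prems"] by blast
      show "total_codiff b (\<lambda>J u. ?\<phi> J u K v) J u
        = lift F (\<lambda>ys. g ((deg u - ldim J + 1, total_codiff b F J u) # ys)) K v"
        using total_codiff_slot[of "\<lambda>p x. lift F (\<lambda>ys. g ((p, x) # ys)) K v", OF additive_slot[OF "1.prems"]] .
    qed
    finally show ?thesis .
  qed
qed


section \<open>The Bianchi identity\<close>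

text \<open>
  Coassociativity on pairs. Signs agree because dimensions add up when a face is cut.
\<close>

lemma coproduct_assoc:
  "coproduct (\<lambda>J u K v. coproduct (\<lambda>J1 u1 J2 u2. \<chi> J1 u1 J2 u2 K v) J u) I w =
   coproduct (\<lambda>J u K v. face_cut_sum (\<lambda>K1 K2. \<chi> J u K1 [] K2 v) K
      + coproduct (\<lambda>K1 v1 K2 v2. \<chi> J u K1 v1 K2 v2) K v) I w"
proof -
  have "coproduct (\<lambda>J u K v. coproduct (\<lambda>J1 u1 J2 u2. \<chi> J1 u1 J2 u2 K v) J u) I w =
    face_cut_sum (\<lambda>J K. face_cut_sum (\<lambda>J1 J2. cut_sum (\<lambda>u v. cut_sum (\<lambda>u1 u2.
      signed (ldim K * (deg u1 + deg u2) + ldim J2 * deg u1) (\<chi> J1 u1 J2 u2 K v)) u) w) J) I"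
    unfolding coproduct_def cut_sum_face_cut_sum[symmetric] additive_face_cut_sum[OF additive_signed]
      additive_cut_sum[OF additive_signed] signed_signed
    by (intro cut_sum_cong face_cut_sum_cong refl) auto
  also have "\<dots> = face_cut_sum (\<lambda>J K. face_cut_sum (\<lambda>K1 K2. cut_sum (\<lambda>u v.
        signed (ldim K2 * (deg u + 0) + ldim K1 * deg u) (\<chi> J u K1 [] K2 v) + cut_sum (\<lambda>v1 v2.
      signed (ldim K2 * (deg u + deg v1) + ldim K1 * deg u) (\<chi> J u K1 v1 K2 v2)) v) w) K) I"
    unfolding cut_sum_assoc deg_simps by (rule face_cut_sum_assoc)
  also have "\<dots> = face_cut_sum (\<lambda>J K. face_cut_sum (\<lambda>K1 K2. cut_sum (\<lambda>u v.
        signed (ldim K * deg u) (\<chi> J u K1 [] K2 v) + cut_sum (\<lambda>v1 v2.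
      signed (ldim K * deg u + ldim K2 * deg v1) (\<chi> J u K1 v1 K2 v2)) v) w) K) I"
  proof (intro face_cut_sum_cong refl)
    fix J K K1 K2 :: "nat list" and i assume "i < length K" "K1 = take (Suc i) K" "K2 = drop i K"
    then have ldim: "ldim K = ldim K1 + ldim K2" by simp
    show "cut_sum (\<lambda>u v.
        signed (ldim K2 * (deg u + 0) + ldim K1 * deg u) (\<chi> J u K1 [] K2 v) + cut_sum (\<lambda>v1 v2.
      signed (ldim K2 * (deg u + deg v1) + ldim K1 * deg u) (\<chi> J u K1 v1 K2 v2)) v) w
      = cut_sum (\<lambda>u v.
        signed (ldim K * deg u) (\<chi> J u K1 [] K2 v) + cut_sum (\<lambda>v1 v2.
      signed (ldim K * deg u + ldim K2 * deg v1) (\<chi> J u K1 v1 K2 v2)) v) w"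
      unfolding ldim
      by (intro cut_sum_cong refl arg_cong2[where f = "(+)"] signed_parity) (simp_all add: algebra_simps)
  qed
  also have "\<dots> = coproduct (\<lambda>J u K v. face_cut_sum (\<lambda>K1 K2. \<chi> J u K1 [] K2 v) K
      + coproduct (\<lambda>K1 v1 K2 v2. \<chi> J u K1 v1 K2 v2) K v) I w"
    unfolding coproduct_def cut_sum_face_cut_sum[symmetric] additive_face_cut_sum[OF additive_signed]
      additive_cut_sum[OF additive_signed] signed_signed signed_add face_cut_sum_add ..
  finally show ?thesis .
qed

text \<open>
  The counit axiom: only the cut at the first vertex has a first part of dimension 0.
\<close>

lemma counit_face_cut_sum:
  assumes "\<chi> [] = 0"
  shows "face_cut_sum (\<lambda>K1 K2. if length K1 = 1 then \<chi> K2 else 0) K = \<chi> K"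
proof (cases K)
  case (Cons a K')
  have "face_cut_sum (\<lambda>K1 K2. if length (a # K1) = 1 then \<chi> K2 else 0) K' = face_cut_sum (\<lambda>K1 K2. 0) K'"
    by (intro face_cut_sum_cong refl) auto
  then show ?thesis by (simp add: Cons) (simp add: face_cut_sum_def)
qed (use assms in simp)

text \<open>
  The lift is compatible with the coproducts. Cutting the output after its first letter meets the empty
  word in the middle, where the counit axiom applies.
\<close>

lemma lift_cut_sum:
  "lift F (cut_sum \<phi>) I w = coproduct (\<lambda>J u K v. lift F (\<lambda>y2. lift F (\<lambda>y1. \<phi> y1 y2) J u) K v) I w"
proof (induction w arbitrary: \<phi> I rule: length_induct)
  case (1 w)
  show ?case
  proof (cases "w = []")
    case False
    let ?l = "\<lambda>J u. (deg u - ldim J, F J u)"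
    let ?\<chi> = "\<lambda>J u K1 v1 K2 v2. lift F (\<lambda>y2. lift F (\<lambda>y1. \<phi> (?l J u # y1) y2) K1 v1) K2 v2"
    have "lift F (cut_sum \<phi>) I w = coproduct (\<lambda>J u K v. lift F (\<phi> [?l J u]) K v
         + lift F (cut_sum (\<lambda>y. \<phi> (?l J u # y))) K v) I w"
      by (simp add: lift_coproduct[OF False] lift_add)
    also have "\<dots> = coproduct (\<lambda>J u K v. face_cut_sum (\<lambda>K1 K2. ?\<chi> J u K1 [] K2 v) K
         + coproduct (?\<chi> J u) K v) I w"
    proof (intro coproduct_cong refl arg_cong2[where f = "(+)"])
      fix J u K v assume "u @ v = w" "u \<noteq> []"
      then have "length v < length w" by (rule cut_length)
      then show "lift F (cut_sum (\<lambda>y. \<phi> (?l J u # y))) K v = coproduct (?\<chi> J u) K v"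
        using "1.IH" by blast
      have "?\<chi> J u K1 [] K2 v = (if length K1 = 1 then lift F (\<phi> [?l J u]) K2 v else 0)" for K1 K2
        by (simp add: lift_zero)
      then show "lift F (\<phi> [?l J u]) K v = face_cut_sum (\<lambda>K1 K2. ?\<chi> J u K1 [] K2 v) K"
        using counit_face_cut_sum[of "\<lambda>K. lift F (\<phi> [?l J u]) K v" K] by simp
    qed
    also have "\<dots> = coproduct (\<lambda>J u K v. coproduct (\<lambda>J1 u1 J2 u2. ?\<chi> J1 u1 J2 u2 K v) J u) I w"
      by (rule coproduct_assoc[symmetric])
    also have "\<dots> = coproduct (\<lambda>J u K v. lift F (\<lambda>y2. lift F (\<lambda>y1. \<phi> y1 y2) J u) K v) I w"
      by (intro coproduct_cong refl) (simp add: lift_coproduct_swap[symmetric] lift_coproduct)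
    finally show ?thesis .
  qed simp
qed

text \<open>
  Composing a coalgebra morphism with the differential of its target also gives a coderivation along it;
  its components are the sums \<open>b(F \<otimes> \<dots> \<otimes> F)\<close>.
\<close>

lemma lift_codiff:
  assumes "multiadditive g"
  shows "lift F (codiff b g) I w = lift_insert F (lift F b) g I w"
  using assms
proof (induction w arbitrary: g I rule: length_induct)
  case (1 w)
  show ?case
  proof (cases "w = []")
    case False
    let ?l = "\<lambda>J u. (deg u - ldim J, F J u)"
    let ?h = "\<lambda>u v. g ((deg u + 1, b u) # v)"
    have "lift F (codiff b g) I w = coproduct (\<lambda>J u K v. lift F (\<lambda>ys. cut_sum ?h (?l J u # ys)) K v
       + signed (deg u - ldim J) (lift F (codiff b (\<lambda>ys. g (?l J u # ys))) K v)) I w"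
      unfolding lift_coproduct[OF False] codiff.simps lift_add lift_signed fst_conv ..
    also have "\<dots> = lift F (cut_sum ?h) I w
       + coproduct (\<lambda>J u K v. signed (deg u - ldim J) (lift F (codiff b (\<lambda>ys. g (?l J u # ys))) K v)) I w"
      unfolding coproduct_add lift_coproduct[OF False] ..
    also have "lift F (cut_sum ?h) I w
      = coproduct (\<lambda>J u K v. lift F (\<lambda>ys. g ((deg u - ldim J + 1, lift F b J u) # ys)) K v) I w"
      unfolding lift_cut_sum lift_slot[OF "1.prems"] ..
    also have "coproduct (\<lambda>J u K v. signed (deg u - ldim J) (lift F (codiff b (\<lambda>ys. g (?l J u # ys))) K v)) I w
      = coproduct (\<lambda>J u K v. signed (deg u - ldim J) (lift_insert F (lift F b) (\<lambda>ys. g (?l J u # ys)) K v)) I w"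
      by (intro coproduct_cong refl arg_cong[where f = "signed _"] "1.IH"[rule_format] cut_length
          multiadditive_Cons[OF "1.prems"])
    finally show ?thesis
      unfolding coproduct_add[symmetric] lift_insert_coproduct[of F "lift F b" g] .
  qed simp
qed

lemma total_codiff_diff:
  "total_codiff b (\<lambda>J u. \<phi> J u - \<psi> J u) I w = total_codiff b \<phi> I w - total_codiff b \<psi> I w"
  by (simp add: total_codiff_def boundary_sum_diff codiff_diff signed_diff)

text \<open>
  On face maps this is the difference of the two sides of the morphism equation (\<open>defect_face_map\<close>).
\<close>

definition defect where
  "defect bA bB F I w = total_codiff bA F I w - lift F bB I w"

text \<open>
  The Bianchi identity. If \<open>\<Phi>\<close> is the lift of \<open>F\<close>, then \<open>defect\<close> is the component of \<open>\<Phi> d - d \<Phi>\<close>. The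
  total differential of \<open>total_codiff bA F\<close> vanishes and that of \<open>lift F bB\<close> inserts \<open>total_codiff bA F\<close>.
  There the latter may be replaced by the defect, as inserting \<open>lift F bB\<close> gives \<open>d d\<close> on the target.
\<close>

lemma total_codiff_defect:
  assumes F: "\<And>J. multiadditive (F J)" "\<And>u. F [] u = 0" and "multiadditive bB"
    and A: "\<And>u v t. u @ v @ t = w \<Longrightarrow> codiff bA bA v = 0"
    and B: "lift F (codiff bB bB) I w = 0"
  shows "total_codiff bA (defect bA bB F) I w = - lift_insert F (defect bA bB F) bB I w"
proof -
  have "total_codiff bA (defect bA bB F) I w = - lift_insert F (total_codiff bA F) bB I w"
    unfolding defect_def[abs_def] total_codiff_diff total_codiff_lift[OF assms(3), of F, OF F(2)]
    using total_codiff_total_codiff[of F w bA I] F(1) A by simp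
  moreover have "lift_insert F (lift F bB) bB I w = 0"
    using B lift_codiff[OF assms(3)] by metis
  ultimately show ?thesis
    by (simp add: defect_def[abs_def] lift_insert_diff[OF assms(3)])
qed

text \<open>
  The faces that occur in an iterated coproduct are the segments of \<open>I\<close>; this is what makes an inner facet
  invisible to the right-hand side of the equation of \<open>I\<close>.
\<close>

lemma lift_insert_eq_0:
  assumes "multiadditive g"
    and "\<And>L J M t u v. L @ J @ M = I \<Longrightarrow> t @ u @ v = w \<Longrightarrow> J \<noteq> [] \<Longrightarrow> u \<noteq> [] \<Longrightarrow> R J u = 0"
  shows "lift_insert F R g I w = 0"
  using assms
proof (induction w arbitrary: g I rule: length_induct)
  case (1 w)
  have "lift_insert F R g I w = coproduct (\<lambda>J u K v. 0) I w"
    unfolding lift_insert_coproduct[of F R g]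
  proof (intro coproduct_cong refl)
    fix J u K v i
    assume i: "i < length I" "J = take (Suc i) I" "K = drop i I" "u @ v = w" "u \<noteq> []"
    have "R J u = 0"
      by (rule "1.prems"(2)[of "[]" J "drop (Suc i) I" "[]" u v]) (use i in auto)
    moreover have "lift_insert F R (\<lambda>ys. g ((deg u - ldim J, F J u) # ys)) K v = 0"
    proof (rule "1.IH"[rule_format])
      show "length v < length w" using i by auto
      show "multiadditive (\<lambda>ys. g ((deg u - ldim J, F J u) # ys))"
        by (rule multiadditive_Cons[OF "1.prems"(1)])
      fix L J' M t u' v' assume "L @ J' @ M = K" "t @ u' @ v' = v" "J' \<noteq> []" "u' \<noteq> []"
      then show "R J' u' = 0"
        using i by (intro "1.prems"(2)[of "take i I @ L" J' M "u @ t" u' v']) auto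
    qed
    ultimately show "lift F (\<lambda>ys. g ((deg u - ldim J + 1, R J u) # ys)) K v
       + signed (deg u - ldim J) (lift_insert F R (\<lambda>ys. g ((deg u - ldim J, F J u) # ys)) K v) = 0"
      using additive.zero[OF additive_slot[OF "1.prems"(1)]] by simp
  qed
  then show ?case by (simp add: coproduct_zero)
qed

lemma lift_cong_map:
  assumes "\<And>L J M t u v. L @ J @ M = I \<Longrightarrow> t @ u @ v = w \<Longrightarrow> J \<noteq> [] \<Longrightarrow> u \<noteq> [] \<Longrightarrow> F J u = F' J u"
  shows "lift F g I w = lift F' g I w"
  using assms
proof (induction w arbitrary: g I rule: length_induct)
  case (1 w)
  show ?case
  proof (cases "w = []")
    case False
    show ?thesis
      unfolding lift_coproduct[OF False]
    proof (intro coproduct_cong refl)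
      fix J u K v i
      assume i: "i < length I" "J = take (Suc i) I" "K = drop i I" "u @ v = w" "u \<noteq> []"
      have eq: "F J u = F' J u"
        by (rule "1.prems"[of "[]" J "drop (Suc i) I" "[]" u v]) (use i in auto)
      show "lift F (\<lambda>ys. g ((deg u - ldim J, F J u) # ys)) K v = lift F' (\<lambda>ys. g ((deg u - ldim J, F' J u) # ys)) K v"
        unfolding eq
      proof (rule "1.IH"[rule_format])
        show "length v < length w" using i by auto
        fix L J' M t u' v' assume "L @ J' @ M = K" "t @ u' @ v' = v" "J' \<noteq> []" "u' \<noteq> []"
        then show "F J' u' = F' J' u'"
          using i by (intro "1.prems"[of "take i I @ L" J' M "u @ t" u' v']) auto
      qed
    qed
  qed simp
qed


section \<open>Additivity and degrees\<close>

text \<open>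
  A marked letter lies on one side of each cut. The induction hypothesis in \<open>multiadditive_lift\<close> covers
  only words shorter than the whole one, hence the formulation at a fixed letter.
\<close>

lemma multiadditive_at_cut_sum:
  assumes "\<And>u1 u2. u1 @ u2 = u \<Longrightarrow> u1 \<noteq> [] \<Longrightarrow> \<psi> u1 (u2 @ (p, x + y) # v) = \<psi> u1 (u2 @ (p, x) # v) + \<psi> u1 (u2 @ (p, y) # v)"
    and "\<And>v1 v2. v1 @ v2 = v \<Longrightarrow> \<psi> (u @ (p, x + y) # v1) v2 = \<psi> (u @ (p, x) # v1) v2 + \<psi> (u @ (p, y) # v1) v2"
  shows "cut_sum \<psi> (u @ (p, x + y) # v) = cut_sum \<psi> (u @ (p, x) # v) + cut_sum \<psi> (u @ (p, y) # v)"
proof -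
  have 1: "cut_sum (\<lambda>u1 u2. \<psi> u1 (u2 @ (p, x + y) # v)) u
     = cut_sum (\<lambda>u1 u2. \<psi> u1 (u2 @ (p, x) # v) + \<psi> u1 (u2 @ (p, y) # v)) u"
    by (intro cut_sum_cong refl assms(1))
  have 2: "cut_sum (\<lambda>v1. \<psi> (u @ (p, x + y) # v1)) v
     = cut_sum (\<lambda>v1 v2. \<psi> (u @ (p, x) # v1) v2 + \<psi> (u @ (p, y) # v1) v2) v"
    by (intro cut_sum_cong refl assms(2))
  show ?thesis
    using assms(2)[of "[]" v]
    by (simp add: cut_sum_append 1 2 cut_sum_add algebra_simps)
qed

lemma multiadditive_codiff:
  assumes "multiadditive b" "multiadditive \<phi>"
  shows "multiadditive (codiff b \<phi>)"
  unfolding multiadditive_def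
proof (intro allI)
  fix u v p x y
  show "codiff b \<phi> (u @ (p, x + y) # v) = codiff b \<phi> (u @ (p, x) # v) + codiff b \<phi> (u @ (p, y) # v)"
    using assms(2)
  proof (induction u arbitrary: \<phi>)
    case Nil
    have "codiff b (\<lambda>w. \<phi> ((p, x + y) # w)) v = codiff b (\<lambda>w. \<phi> ((p, x) # w) + \<phi> ((p, y) # w)) v"
      by (intro codiff_cong multiadditiveD[OF Nil, of "[]", simplified])
    then have 1: "codiff b (\<lambda>w. \<phi> ((p, x + y) # w)) v
       = codiff b (\<lambda>w. \<phi> ((p, x) # w)) v + codiff b (\<lambda>w. \<phi> ((p, y) # w)) v"
      by (simp only: codiff_add)
    have "cut_sum (\<lambda>u v. \<phi> ((deg u + 1, b u) # v)) ([] @ (p, x + y) # v)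
      = cut_sum (\<lambda>u v. \<phi> ((deg u + 1, b u) # v)) ([] @ (p, x) # v)
        + cut_sum (\<lambda>u v. \<phi> ((deg u + 1, b u) # v)) ([] @ (p, y) # v)"
      by (rule multiadditive_at_cut_sum)
        (auto simp: multiadditiveD[OF assms(1), of "[]", simplified] multiadditiveD[OF Nil, of "[]", simplified])
    then show ?case by (simp add: codiff.simps 1 signed_add del: cut_sum_simps)
  next
    case (Cons z u)
    have "cut_sum (\<lambda>u v. \<phi> ((deg u + 1, b u) # v)) ((z # u) @ (p, x + y) # v)
      = cut_sum (\<lambda>u v. \<phi> ((deg u + 1, b u) # v)) ((z # u) @ (p, x) # v)
        + cut_sum (\<lambda>u v. \<phi> ((deg u + 1, b u) # v)) ((z # u) @ (p, y) # v)"
    proof (rule multiadditive_at_cut_sum)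
      fix u1 u2 :: "'a word"
      show "\<phi> ((deg u1 + 1, b u1) # u2 @ (p, x + y) # v) = \<phi> ((deg u1 + 1, b u1) # u2 @ (p, x) # v)
        + \<phi> ((deg u1 + 1, b u1) # u2 @ (p, y) # v)"
        using multiadditiveD[OF Cons.prems, of "(deg u1 + 1, b u1) # u2"] by simp
    qed (auto simp: multiadditiveD[OF assms(1), of "_ # _", simplified] multiadditiveD[OF Cons.prems, of "[]", simplified])
    then show ?case
      using Cons.IH[OF multiadditive_Cons[OF Cons.prems]]
      by (simp add: codiff.simps signed_add del: cut_sum_simps)
  qed
qed

lemma multiadditive_total_codiff:
  assumes "multiadditive b" "\<And>J. multiadditive (\<phi> J)"
  shows "multiadditive (total_codiff b \<phi> I)"
  using multiadditive_codiff[OF assms(1) assms(2), of I] assms(2)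
  by (simp add: multiadditive_def total_codiff_def signed_add boundary_sum_add)

lemma multiadditive_lift:
  assumes F: "\<And>J. multiadditive (F J)" and "multiadditive g"
  shows "multiadditive (lift F g I)"
  unfolding multiadditive_def
proof (intro allI)
  fix u v p x y
  have "\<forall>u v. w = u @ (p, x + y) # v \<longrightarrow>
      lift F g I w = lift F g I (u @ (p, x) # v) + lift F g I (u @ (p, y) # v)" for w
    using assms(2)
  proof (induction w arbitrary: g I rule: length_induct)
    case (1 w)
    show ?case
    proof (intro allI impI)
      fix u v assume w: "w = u @ (p, x + y) # v"
      have "coproduct (\<lambda>J u K v. lift F (\<lambda>ys. g ((deg u - ldim J, F J u) # ys)) K v) I w =
         coproduct (\<lambda>J u K v. lift F (\<lambda>ys. g ((deg u - ldim J, F J u) # ys)) K v) I (u @ (p, x) # v)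
         + coproduct (\<lambda>J u K v. lift F (\<lambda>ys. g ((deg u - ldim J, F J u) # ys)) K v) I (u @ (p, y) # v)"
        unfolding coproduct_def w face_cut_sum_add[symmetric]
      proof (intro face_cut_sum_cong refl multiadditive_at_cut_sum)
        fix J K u1 u2
        assume "u1 @ u2 = u" "u1 \<noteq> []"
        then have "length (u2 @ (p, x + y) # v) < length w" using w by auto
        then show "signed (ldim K * deg u1) (lift F (\<lambda>ys. g ((deg u1 - ldim J, F J u1) # ys)) K (u2 @ (p, x + y) # v))
          = signed (ldim K * deg u1) (lift F (\<lambda>ys. g ((deg u1 - ldim J, F J u1) # ys)) K (u2 @ (p, x) # v))
           + signed (ldim K * deg u1) (lift F (\<lambda>ys. g ((deg u1 - ldim J, F J u1) # ys)) K (u2 @ (p, y) # v))"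
          unfolding signed_add[symmetric]
          using "1.IH" multiadditive_Cons[OF "1.prems"] by metis
      next
        fix J K v1 v2
        show "signed (ldim K * deg (u @ (p, x + y) # v1))
            (lift F (\<lambda>ys. g ((deg (u @ (p, x + y) # v1) - ldim J, F J (u @ (p, x + y) # v1)) # ys)) K v2) =
          signed (ldim K * deg (u @ (p, x) # v1))
            (lift F (\<lambda>ys. g ((deg (u @ (p, x) # v1) - ldim J, F J (u @ (p, x) # v1)) # ys)) K v2) +
          signed (ldim K * deg (u @ (p, y) # v1))
            (lift F (\<lambda>ys. g ((deg (u @ (p, y) # v1) - ldim J, F J (u @ (p, y) # v1)) # ys)) K v2)"
          by (simp add: multiadditiveD[OF F] additive.add[OF additive_slot[OF "1.prems"]] signed_add)
      qed
      then show "lift F g I w = lift F g I (u @ (p, x) # v) + lift F g I (u @ (p, y) # v)"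
        by (simp add: lift_coproduct w)
    qed
  qed
  then show "lift F g I (u @ (p, x + y) # v) = lift F g I (u @ (p, x) # v) + lift F g I (u @ (p, y) # v)"
    by blast
qed

definition homogeneous_word :: "(int \<Rightarrow> 'a set) \<Rightarrow> 'a word \<Rightarrow> bool" where
  "homogeneous_word V w \<longleftrightarrow> (\<forall>(p, x) \<in> set w. x \<in> V p)"

lemma homogeneous_word_simps [simp]:
  "homogeneous_word V []" "homogeneous_word V (z # w) \<longleftrightarrow> snd z \<in> V (fst z) \<and> homogeneous_word V w"
  "homogeneous_word V (u @ v) \<longleftrightarrow> homogeneous_word V u \<and> homogeneous_word V v"
  by (auto simp: homogeneous_word_def split: prod.splits)

definition subgroup_set :: "'a::ab_group_add set \<Rightarrow> bool" where
  "subgroup_set S \<longleftrightarrow> 0 \<in> S \<and> (\<forall>x\<in>S. \<forall>y\<in>S. x + y \<in> S) \<and> (\<forall>x\<in>S. - x \<in> S)"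

lemma subgroup_set_0: "subgroup_set {0}"
  by (simp add: subgroup_set_def)

lemma subgroup_setD:
  assumes "subgroup_set S"
  shows "0 \<in> S" "x \<in> S \<Longrightarrow> y \<in> S \<Longrightarrow> x + y \<in> S" "x \<in> S \<Longrightarrow> signed e x \<in> S"
    "x \<in> S \<Longrightarrow> y \<in> S \<Longrightarrow> x - y \<in> S"
  using assms unfolding subgroup_set_def signed_def
  by (auto simp: diff_conv_add_uminus simp del: add_uminus_conv_diff)

lemma subgroup_set_sum:
  "subgroup_set S \<Longrightarrow> (\<And>i. i \<in> N \<Longrightarrow> f i \<in> S) \<Longrightarrow> sum f N \<in> S"
  by (induction N rule: infinite_finite_induct) (auto simp: subgroup_setD)

lemma cut_sum_mem:
  assumes "subgroup_set S" and "\<And>u v. u @ v = w \<Longrightarrow> u \<noteq> [] \<Longrightarrow> \<phi> u v \<in> S"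
  shows "cut_sum \<phi> w \<in> S"
  unfolding cut_sum_def by (intro subgroup_set_sum assms) auto

lemma codiff_mem:
  assumes "subgroup_set S"
    and "\<And>u v t. u @ v @ t = w \<Longrightarrow> v \<noteq> [] \<Longrightarrow> \<phi> (u @ (deg v + 1, b v) # t) \<in> S"
  shows "codiff b \<phi> w \<in> S"
  using assms(2)
proof (induction w arbitrary: \<phi>)
  case (Cons z w)
  have "codiff b (\<lambda>w. \<phi> (z # w)) w \<in> S"
  proof (rule Cons.IH)
    fix u v t assume "u @ v @ t = w" "v \<noteq> []"
    then show "\<phi> (z # u @ (deg v + 1, b v) # t) \<in> S"
      using Cons.prems[of "z # u" v t] by simp
  qed
  moreover have "cut_sum (\<lambda>u v. \<phi> ((deg u + 1, b u) # v)) (z # w) \<in> S"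
    by (rule cut_sum_mem[OF assms(1)]) (use Cons.prems[of "[]"] in auto)
  ultimately show ?case
    by (simp add: codiff.simps subgroup_setD[OF assms(1)] del: cut_sum_simps)
qed (simp add: subgroup_setD[OF assms(1)])

lemma lift_mem:
  assumes S: "subgroup_set S"
    and F: "\<And>J u. homogeneous_word V u \<Longrightarrow> u \<noteq> [] \<Longrightarrow> F J u \<in> W (deg u - ldim J)"
    and "homogeneous_word V w"
    and "\<And>ys. homogeneous_word W ys \<Longrightarrow> deg ys = deg w - ldim I \<Longrightarrow> (ys = [] \<Longrightarrow> w = []) \<Longrightarrow> g ys \<in> S"
  shows "lift F g I w \<in> S"
  using assms(3,4)
proof (induction w arbitrary: g I rule: length_induct)
  case (1 w)
  show ?case
  proof (cases "w = []")
    case True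
    then show ?thesis using "1.prems"(2)[of "[]"] subgroup_setD(1)[OF S] by simp
  next
    case False
    show ?thesis
      unfolding lift_coproduct[OF False] coproduct_def face_cut_sum_def
    proof (intro subgroup_set_sum[OF S] cut_sum_mem[OF S] subgroup_setD(3)[OF S])
      fix i u v assume i: "i \<in> {..<length I}" "u @ v = w" "u \<noteq> []"
      let ?J = "take (Suc i) I" and ?K = "drop i I"
      from i have ldim: "deg w - ldim I = (deg u - ldim ?J) + (deg v - ldim ?K)" by auto
      show "lift F (\<lambda>ys. g ((deg u - ldim ?J, F ?J u) # ys)) ?K v \<in> S"
      proof (rule "1.IH"[rule_format])
        show "length v < length w" "homogeneous_word V v" using i "1.prems"(1) by auto
        have "F ?J u \<in> W (deg u - ldim ?J)" using i "1.prems"(1) by (intro F) auto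
        moreover fix ys assume "homogeneous_word W ys" "deg ys = deg v - ldim ?K"
        ultimately show "g ((deg u - ldim ?J, F ?J u) # ys) \<in> S"
          by (intro "1.prems"(2)) (simp_all only: ldim deg_simps fst_conv snd_conv list.distinct homogeneous_word_simps)
      qed
    qed
  qed
qed


section \<open>The sum over insertions as the bar differential\<close>

definition word_map :: "(nat \<Rightarrow> 'a list \<Rightarrow> 'c) \<Rightarrow> 'a word \<Rightarrow> 'c" where
  "word_map f u = f (length u) (map snd u)"

lemma insertions_0: "insertions 0 = {}"
  by (auto simp: insertions_def)

lemma insertions_Suc:
  "insertions (Suc m) = (\<lambda>i. (0, Suc i, m - i)) ` {..<Suc m}
     \<union> (\<lambda>t. (Suc (fst t), snd t)) ` insertions m"
proof (intro set_eqI iffI)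
  fix t assume "t \<in> insertions (Suc m)"
  then obtain i1 i2 i3 where t: "t = (i1, i2, i3)" "1 \<le> i2" "i1 + i2 + i3 = Suc m"
    by (auto simp: insertions_def)
  show "t \<in> (\<lambda>i. (0, Suc i, m - i)) ` {..<Suc m}
     \<union> (\<lambda>t. (Suc (fst t), snd t)) ` insertions m"
  proof (cases i1)
    case 0
    then have "t = (\<lambda>i. (0, Suc i, m - i)) (i2 - 1)" "i2 - 1 < Suc m" using t by auto
    then show ?thesis by blast
  next
    case (Suc i)
    then have "t = (\<lambda>t. (Suc (fst t), snd t)) (i, i2, i3)" "(i, i2, i3) \<in> insertions m"
      using t by (auto simp: insertions_def)
    then show ?thesis by blast
  qed
qed (auto simp: insertions_def)

lemma codiff_eq_sum_insertions:
  "codiff b \<phi> w = (\<Sum>(i1, i2, i3) \<in> insertions (length w). signed (deg (take i1 w))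
     (\<phi> (take i1 w @ (deg (take i2 (drop i1 w)) + 1, b (take i2 (drop i1 w))) # drop (i1 + i2) w)))"
proof (induction w arbitrary: \<phi>)
  case Nil
  show ?case by (simp add: insertions_0)
next
  case (Cons z w)
  have inj: "inj_on (\<lambda>i. (0::nat, Suc i, length w - i)) {..<Suc (length w)}"
    "inj_on (\<lambda>t. (Suc (fst t), snd t)) (insertions (length w))"
    by (auto simp: inj_on_def)
  show ?case
    unfolding list.size add_0_right add_Suc_right insertions_Suc codiff.simps
    by (subst sum.union_disjoint)
      (auto simp: finite_insertions Cons.IH sum.reindex[OF inj(1)] sum.reindex[OF inj(2)] cut_sum_def
        signed_sum signed_signed case_prod_unfold simp del: cut_sum_simps sum.lessThan_Suc)
qed

lemma tensor_values_replicate_id: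
  "i \<le> length xs \<Longrightarrow> tensor_values (replicate i id_map @ fs) xs = take i xs @ tensor_values fs (drop i xs)"
proof (induction i arbitrary: xs)
  case (Suc i)
  then show ?case by (cases xs) (auto simp: id_map_def)
qed simp

lemma koszul_replicate_id:
  "i \<le> length ps \<Longrightarrow> koszul (replicate i id_map @ fs) ps =
     (\<Sum>(i', d', f') \<leftarrow> fs. d') * sum_list (take i ps) + koszul fs (drop i ps)"
proof (induction i arbitrary: ps)
  case (Suc i)
  then obtain p qs where ps: "ps = p # qs" by (cases ps) auto
  have "(\<Sum>(i', d', f') \<leftarrow> replicate i id_map. d') = 0"
    by (induction i) (auto simp: id_map_def)
  with Suc show ?case by (auto simp: id_map_def ps algebra_simps)
qed simp

lemma insertion_sum_eq_codiff:
  fixes g :: "nat \<Rightarrow> 'a::ab_group_add list \<Rightarrow> 'b::ab_group_add"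
  shows "insertion_sum g b (length w) (map fst w) (map snd w) = codiff (word_map b) (word_map g) w"
  unfolding insertion_sum_def codiff_eq_sum_insertions
proof (intro sum.cong refl, clarify)
  fix i1 i2 i3 assume "(i1, i2, i3) \<in> insertions (length w)"
  then have i: "i1 + i2 + i3 = length w" by (auto simp: insertions_def)
  define u v t where "u = take i1 w" and "v = take i2 (drop i1 w)" and "t = drop (i1 + i2) w"
  then have len: "length u = i1" "length v = i2" "length t = i3" and w: "w = u @ v @ t"
    using i by (auto simp: min_def) (metis add.commute append_take_drop_id drop_drop)
  have 1: "tensor_values (replicate i3 id_map) (map snd t) = map snd t"
    using tensor_values_replicate_id[of i3 "map snd t" "[]"] len by simp
  have 2: "koszul (replicate i3 (id_map :: ('a, 'a) hmap)) (map fst t) = 0"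
    using koszul_replicate_id[of i3 "map fst t" "[]"] len by simp
  have 3: "sum_list (replicate i3 (case id_map :: ('a, 'a) hmap of (i', d', f') \<Rightarrow> d')) = 0"
    by (induction i3) (auto simp: id_map_def)
  show "comp_tensor (g (i1 + 1 + i3)) (replicate i1 id_map @ [(i2, 1, b i2)] @ replicate i3 id_map)
      (map fst w) (map snd w)
    = signed (deg (take i1 w)) (word_map g (take i1 w @
       (deg (take i2 (drop i1 w)) + 1, word_map b (take i2 (drop i1 w))) # drop (i1 + i2) w))"
    unfolding comp_tensor_def w
    by (simp add: tensor_values_replicate_id koszul_replicate_id word_map_def deg_def len 1 2 3)
qed


section \<open>Overlapping partitions as iterated coproducts\<close>

text \<open>
  For the empty word the recursion of \<open>lift\<close> ends at a single vertex with no pieces left, whereas an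
  overlapping partition of a nonempty face has at least one piece.
\<close>

definition decompositions :: "nat set \<Rightarrow> nat \<Rightarrow> (nat list \<times> nat set list) set" where
  "decompositions S m =
     (if m = 0 then if card S = 1 then {([], [])} else {} else overlapping_decompositions S m)"

lemma overlapping_partition_single: "overlapping_partition S [J] \<longleftrightarrow> J = S \<and> S \<noteq> {}"
  by (auto simp: overlapping_partition_def)

text \<open>
  Consecutive pieces touch, so a piece begins where all earlier ones have ended.
\<close>

lemma overlapping_partition_Min_le:
  assumes "overlapping_partition S Is" "finite S" "Is \<noteq> []" "x \<in> S"
  shows "Min (hd Is) \<le> x"
  using assms
proof (induction Is arbitrary: S)
  case (Cons J Is)
  have J: "finite J" "J \<noteq> {}"
    using Cons.prems(1,2) by (auto simp: overlapping_partition_def intro: finite_subset)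
  show ?case
  proof (cases "x \<in> J")
    case False
    let ?T = "\<Union> (set Is)"
    from False Cons.prems have x: "x \<in> ?T" and ne: "Is \<noteq> []"
      by (auto simp: overlapping_partition_def)
    have "overlapping_partition ?T Is"
      unfolding overlapping_partition_def
    proof (intro conjI ballI allI impI refl)
      fix l assume "l + 1 < length Is"
      then show "Max (Is ! l) = Min (Is ! (l + 1))"
        using Cons.prems(1) unfolding overlapping_partition_def by (auto dest!: spec[of _ "Suc l"])
    qed (use Cons.prems(1) in \<open>auto simp: overlapping_partition_def\<close>)
    moreover have "finite ?T"
      using Cons.prems(1,2) by (auto simp: overlapping_partition_def intro: finite_subset)
    ultimately have "Min (hd Is) \<le> x" using Cons.IH ne x by blast
    moreover have "Max J = Min (hd Is)"
      using Cons.prems(1) ne unfolding overlapping_partition_def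
      by (auto dest!: spec[of _ 0] simp: hd_conv_nth)
    moreover have "Min J \<le> Max J" using J by simp
    ultimately show ?thesis by (simp only: list.sel)
  qed (use J in simp)
qed simp

text \<open>
  Because all later pieces lie above the maximum \<open>a\<close> of the first piece, the first piece contains every
  vertex below \<open>a\<close>: pieces are intervals of \<open>S\<close>. Thus an overlapping partition is an iterated cut.
\<close>

lemma overlapping_partition_Cons:
  assumes "finite S" "Is \<noteq> []"
  shows "overlapping_partition S (J # Is) \<longleftrightarrow>
    (\<exists>a\<in>S. J = {v \<in> S. v \<le> a} \<and> overlapping_partition {v \<in> S. a \<le> v} Is)"
proof
  assume S: "overlapping_partition S (J # Is)"
  let ?T = "\<Union> (set Is)"
  have J: "finite J" "J \<noteq> {}" "J \<subseteq> S"
    using assms S by (auto simp: overlapping_partition_def intro: finite_subset)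
  have T: "finite ?T" using assms S by (auto simp: overlapping_partition_def intro: finite_subset)
  have part: "overlapping_partition ?T Is"
    unfolding overlapping_partition_def
  proof (intro conjI ballI allI impI refl)
    fix l assume "l + 1 < length Is"
    then show "Max (Is ! l) = Min (Is ! (l + 1))"
      using S unfolding overlapping_partition_def by (auto dest!: spec[of _ "Suc l"])
  qed (use S in \<open>auto simp: overlapping_partition_def\<close>)
  have max: "Max J = Min (hd Is)"
    using S assms(2) unfolding overlapping_partition_def
    by (auto dest!: spec[of _ 0] simp: hd_conv_nth)
  have "hd Is \<in> set Is" using assms(2) by simp
  then have "Min (hd Is) \<in> ?T"
    using S finite_subset[OF Union_upper T] Min_in[of "hd Is"]
    by (auto simp: overlapping_partition_def simp del: Min_in)
  then have mT: "Max J \<in> ?T" by (simp only: max)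
  have ge: "Max J \<le> x" if "x \<in> ?T" for x
    using overlapping_partition_Min_le[OF part T assms(2) that] by (simp only: max)
  have SU: "S = J \<union> ?T" using S by (auto simp: overlapping_partition_def)
  have le: "x \<le> Max J" if "x \<in> J" for x using that J(1) by simp
  have MJ: "Max J \<in> J" using J by simp
  have J_eq: "J = {v \<in> S. v \<le> Max J}"
  proof (intro set_eqI iffI)
    fix x assume "x \<in> {v \<in> S. v \<le> Max J}"
    then show "x \<in> J" using SU ge[of x] MJ by (cases "x = Max J") auto
  qed (use le J in auto)
  have T_eq: "?T = {v \<in> S. Max J \<le> v}"
  proof (intro set_eqI iffI)
    fix x assume "x \<in> {v \<in> S. Max J \<le> v}"
    then show "x \<in> ?T" using SU le[of x] mT by (cases "x = Max J") (simp_all only:, auto)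
  qed (use ge SU in auto)
  show "\<exists>a\<in>S. J = {v \<in> S. v \<le> a} \<and> overlapping_partition {v \<in> S. a \<le> v} Is"
    using J(3) MJ J_eq part[unfolded T_eq] by blast
next
  assume "\<exists>a\<in>S. J = {v \<in> S. v \<le> a} \<and> overlapping_partition {v \<in> S. a \<le> v} Is"
  then obtain a where a: "a \<in> S" "J = {v \<in> S. v \<le> a}" and part: "overlapping_partition {v \<in> S. a \<le> v} Is"
    by blast
  have MaxJ: "Max J = a" using a assms(1) by (intro Max_eqI) auto
  have hd: "hd Is \<in> set Is" using assms(2) by simp
  then have "hd Is \<subseteq> {v \<in> S. a \<le> v}" "hd Is \<noteq> {}"
    using part by (auto simp: overlapping_partition_def)
  then have "a \<le> Min (hd Is)"
    using assms(1) by (intro Min.boundedI) (auto intro: finite_subset)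
  moreover have "Min (hd Is) \<le> a"
    using overlapping_partition_Min_le[OF part _ assms(2)] a assms(1) by simp
  ultimately have min: "Min (hd Is) = a" by simp
  show "overlapping_partition S (J # Is)"
    unfolding overlapping_partition_def
  proof (intro conjI ballI allI impI)
    show "\<Union> (set (J # Is)) = S"
      using a part by (auto simp: overlapping_partition_def)
    fix l assume l: "l + 1 < length (J # Is)"
    show "Max ((J # Is) ! l) = Min ((J # Is) ! (l + 1))"
    proof (cases l)
      case 0
      then show ?thesis using MaxJ min assms(2) by (simp add: hd_conv_nth)
    next
      case (Suc l')
      then show ?thesis using part l by (auto simp: overlapping_partition_def)
    qed
  qed (use a part in \<open>auto simp: overlapping_partition_def\<close>)
qed

lemma decompositions_Cons:
  assumes "finite S" "0 < m"
  shows "(ms, Is) \<in> decompositions S m \<longleftrightarrow>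
    (\<exists>a\<in>S. \<exists>i ms' Is'. 1 \<le> i \<and> i \<le> m \<and> ms = i # ms' \<and> Is = {v \<in> S. v \<le> a} # Is'
      \<and> (ms', Is') \<in> decompositions {v \<in> S. a \<le> v} (m - i))"
proof
  assume "(ms, Is) \<in> decompositions S m"
  then have D: "length ms = length Is" "\<forall>i\<in>set ms. 1 \<le> i" "sum_list ms = m" "overlapping_partition S Is"
    using assms by (auto simp: decompositions_def overlapping_decompositions_def)
  then obtain i ms' J Is' where eq: "ms = i # ms'" "Is = J # Is'"
    using assms by (cases ms; cases Is) auto
  show "\<exists>a\<in>S. \<exists>i ms' Is'. 1 \<le> i \<and> i \<le> m \<and> ms = i # ms' \<and> Is = {v \<in> S. v \<le> a} # Is'
      \<and> (ms', Is') \<in> decompositions {v \<in> S. a \<le> v} (m - i)"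
  proof (cases "Is' = []")
    case True
    then have JS: "J = S" "S \<noteq> {}" using D eq overlapping_partition_single by auto
    then have "J = {v \<in> S. v \<le> Max S}" "Max S \<in> S" "{v \<in> S. Max S \<le> v} = {Max S}"
      using assms Max_in[of S] by (auto intro!: antisym[of _ "Max S"] simp del: Max_in)
    then show ?thesis
      using D eq True by (intro bexI[of _ "Max S"] exI[of _ i] exI[of _ ms'] exI[of _ Is'])
        (auto simp: decompositions_def)
  next
    case False
    then obtain a where a: "a \<in> S" "J = {v \<in> S. v \<le> a}" "overlapping_partition {v \<in> S. a \<le> v} Is'"
      using D(4) eq overlapping_partition_Cons[OF assms(1) False] by auto
    moreover have "m - i \<noteq> 0"
      using D eq False by (cases ms') auto
    ultimately show ?thesis
      using D eq by (intro bexI[of _ a] exI[of _ i] exI[of _ ms'] exI[of _ Is'])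
        (auto simp: decompositions_def overlapping_decompositions_def)
  qed
next
  assume "\<exists>a\<in>S. \<exists>i ms' Is'. 1 \<le> i \<and> i \<le> m \<and> ms = i # ms' \<and> Is = {v \<in> S. v \<le> a} # Is'
      \<and> (ms', Is') \<in> decompositions {v \<in> S. a \<le> v} (m - i)"
  then obtain a i ms' Is' where a: "a \<in> S" and i: "1 \<le> i" "i \<le> m" and eq: "ms = i # ms'" "Is = {v \<in> S. v \<le> a} # Is'"
    and D: "(ms', Is') \<in> decompositions {v \<in> S. a \<le> v} (m - i)" by blast
  show "(ms, Is) \<in> decompositions S m"
  proof (cases "m = i")
    case True
    with D have D: "ms' = []" "Is' = []" "card {v \<in> S. a \<le> v} = 1"
      by (auto simp: decompositions_def split: if_splits)
    obtain c where "{v \<in> S. a \<le> v} = {c}"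
      by (rule card_1_singletonE[OF D(3)])
    moreover have "a \<in> {v \<in> S. a \<le> v}" using a by simp
    ultimately have "{v \<in> S. a \<le> v} = {a}" by simp
    then have "v \<le> a" if "v \<in> S" for v using that by (cases "a \<le> v") auto
    then have "{v \<in> S. v \<le> a} = S" by auto
    then show ?thesis
      using True D eq i a overlapping_partition_single[of S S]
      by (auto simp: decompositions_def overlapping_decompositions_def)
  next
    case False
    with D i have D: "length ms' = length Is'" "\<forall>i\<in>set ms'. 1 \<le> i" "sum_list ms' = m - i"
      "overlapping_partition {v \<in> S. a \<le> v} Is'"
      by (auto simp: decompositions_def overlapping_decompositions_def)
    then have "Is' \<noteq> []" using False i by auto
    then have "overlapping_partition S Is"
      using overlapping_partition_Cons[OF assms(1)] D(4) a eq by blast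
    then show ?thesis
      using D i eq assms by (auto simp: decompositions_def overlapping_decompositions_def)
  qed
qed

lemma sorted_take_drop:
  assumes "sorted_wrt (<) I" "i < length I"
  shows "set (take (Suc i) I) = {v \<in> set I. v \<le> I ! i}" "set (drop i I) = {v \<in> set I. I ! i \<le> (v::nat)}"
proof -
  define L M where "L = take i I" and "M = drop (Suc i) I"
  then have I: "I = L @ I ! i # M" "take (Suc i) I = L @ [I ! i]" "drop i I = I ! i # M"
    using assms(2) by (simp_all add: id_take_nth_drop take_Suc_conv_app_nth Cons_nth_drop_Suc)
  have "\<forall>v \<in> set L. v < I ! i" "\<forall>v \<in> set M. I ! i < v"
    using assms(1) by (subst (asm) I(1), simp add: sorted_wrt_append)+
  moreover have "set I = set L \<union> {I ! i} \<union> set M" by (subst I(1)) simp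
  ultimately show "set (take (Suc i) I) = {v \<in> set I. v \<le> I ! i}" "set (drop i I) = {v \<in> set I. I ! i \<le> v}"
    unfolding I(2,3) by auto
qed

lemma sum_decompositions:
  assumes "sorted_wrt (<) I" "0 < m"
  shows "(\<Sum>(ms, Is)\<in>decompositions (set I) m. f ms Is) = (\<Sum>i<length I. \<Sum>j<m.
     \<Sum>(ms, Is)\<in>decompositions (set (drop i I)) (m - Suc j). f (Suc j # ms) (set (take (Suc i) I) # Is))"
proof -
  let ?\<Omega> = "SIGMA i:{..<length I}. SIGMA j:{..<m}. decompositions (set (drop i I)) (m - Suc j)"
  let ?h = "\<lambda>(i, j, ms, Is). (Suc j # ms, set (take (Suc i) I) # Is)"
  have "distinct I" using assms(1) by (simp add: strict_sorted_iff)
  then have card: "card (set (take (Suc i) I)) = Suc i" if "i < length I" for i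
    using distinct_card[of "take (Suc i) I"] that by simp
  have inj: "inj_on ?h ?\<Omega>"
  proof (rule inj_onI)
    fix s t assume st: "s \<in> ?\<Omega>" "t \<in> ?\<Omega>" "?h s = ?h t"
    obtain i j ms Is i' j' ms' Is' where eq: "s = (i, j, ms, Is)" "t = (i', j', ms', Is')"
      by (metis prod_cases4)
    have "set (take (Suc i) I) = set (take (Suc i') I)" "i < length I" "i' < length I"
      using st unfolding eq prod.case by blast+
    then have "i = i'" using card[of i] card[of i'] by (metis nat.inject)
    then show "s = t" using st(3) unfolding eq prod.case by blast
  qed
  have im: "decompositions (set I) m = ?h ` ?\<Omega>"
  proof (intro set_eqI iffI)
    fix d assume d: "d \<in> decompositions (set I) m"
    obtain ms Is where "d = (ms, Is)" by (cases d)
    with d obtain a j ms' Is' where a: "a \<in> set I" and j: "1 \<le> j" "j \<le> m"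
      and eq: "d = (j # ms', {v \<in> set I. v \<le> a} # Is')"
      and D: "(ms', Is') \<in> decompositions {v \<in> set I. a \<le> v} (m - j)"
      using decompositions_Cons[OF finite_set[of I] assms(2), of ms Is] by blast
    from a obtain i where i: "i < length I" "a = I ! i" by (auto simp: in_set_conv_nth)
    have "(i, j - 1, ms', Is') \<in> ?\<Omega>" "d = ?h (i, j - 1, ms', Is')"
      using i(1) j D[unfolded i(2), folded sorted_take_drop[OF assms(1) i(1)]]
        eq[unfolded i(2), folded sorted_take_drop[OF assms(1) i(1)]] by simp_all
    then show "d \<in> ?h ` ?\<Omega>" by (rule rev_image_eqI)
  next
    fix d assume "d \<in> ?h ` ?\<Omega>"
    then obtain i j ms Is where i: "i < length I" "j < m"
      and D: "(ms, Is) \<in> decompositions (set (drop i I)) (m - Suc j)"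
      and d: "d = (Suc j # ms, set (take (Suc i) I) # Is)"
      by (elim imageE SigmaE) (auto simp only: prod.case lessThan_iff split: prod.splits)
    show "d \<in> decompositions (set I) m"
      unfolding d decompositions_Cons[OF finite_set assms(2)]
      using i D unfolding sorted_take_drop[OF assms(1) i(1)]
      by (intro bexI[of _ "I ! i"] exI[of _ "Suc j"] exI[of _ ms] exI[of _ Is] conjI refl) simp_all
  qed
  have fin: "finite (decompositions (set J) p)" for J p
    by (simp add: decompositions_def finite_overlapping_decompositions)
  have "(\<Sum>(ms, Is)\<in>decompositions (set I) m. f ms Is) = (\<Sum>t\<in>?\<Omega>. case ?h t of (ms, Is) \<Rightarrow> f ms Is)"
    unfolding im sum.reindex[OF inj] o_def ..
  then show ?thesis by (simp add: sum.Sigma case_prod_unfold fin)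
qed

text \<open>
  The dimensions of the pieces add up, so the Koszul sign of moving the first word past all remaining pieces
  depends only on the remaining face.
\<close>

lemma decompositions_fdim:
  assumes "finite S" "(ms, Is) \<in> decompositions S m"
  shows "length ms = length Is" "(\<Sum>J\<leftarrow>Is. int (fdim J)) = int (card S) - 1"
proof -
  have "length ms = length Is \<and> (\<Sum>J\<leftarrow>Is. int (fdim J)) = int (card S) - 1"
    using assms
  proof (induction m arbitrary: S ms Is rule: less_induct)
    case (less m)
    show ?case
    proof (cases "m = 0")
      case True
      then show ?thesis using less.prems by (auto simp: decompositions_def split: if_splits)
    next
      case False
      then obtain a i ms' Is' where a: "a \<in> S" and i: "1 \<le> i" "i \<le> m"
        and eq: "ms = i # ms'" "Is = {v \<in> S. v \<le> a} # Is'"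
        and D: "(ms', Is') \<in> decompositions {v \<in> S. a \<le> v} (m - i)"
        using less.prems decompositions_Cons[of S m ms Is] by auto
      have IH: "length ms' = length Is' \<and> (\<Sum>J\<leftarrow>Is'. int (fdim J)) = int (card {v \<in> S. a \<le> v}) - 1"
        using less.IH[OF _ _ D] i False less.prems(1) by simp
      have "{v \<in> S. v \<le> a} \<union> {v \<in> S. a \<le> v} = S" "{v \<in> S. v \<le> a} \<inter> {v \<in> S. a \<le> v} = {a}"
        using a by auto
      then have "card {v \<in> S. v \<le> a} + card {v \<in> S. a \<le> v} = card S + 1"
        using card_Un_Int[of "{v \<in> S. v \<le> a}" "{v \<in> S. a \<le> v}"] less.prems(1) by simp
      moreover have "0 < card {v \<in> S. v \<le> a}" using a less.prems(1) by (auto simp: card_gt_0_iff)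
      then have "int (fdim {v \<in> S. v \<le> a}) = int (card {v \<in> S. v \<le> a}) - 1"
        unfolding fdim_def by linarith
      ultimately show ?thesis using IH by (simp add: eq)
    qed
  qed
  then show "length ms = length Is" "(\<Sum>J\<leftarrow>Is. int (fdim J)) = int (card S) - 1" by auto
qed


section \<open>The morphism equation as a vanishing defect\<close>

text \<open>
  Vertex sets are turned into lists of vertices; lists that are not faces, in particular the empty one,
  are sent to 0.
\<close>

definition face_map :: "nat set set \<Rightarrow> (nat set \<Rightarrow> nat \<Rightarrow> 'a list \<Rightarrow> 'b::ab_group_add) \<Rightarrow> nat list \<Rightarrow> 'a word \<Rightarrow> 'b" where
  "face_map K F J u = (if sorted_wrt (<) J \<and> set J \<in> K then word_map (F (set J)) u else 0)"

abbreviation factors :: "(nat set \<Rightarrow> nat \<Rightarrow> 'a list \<Rightarrow> 'b) \<Rightarrow> nat list \<Rightarrow> nat set list \<Rightarrow> ('a, 'b) hmap list" where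
  "factors F ms Is \<equiv> map2 (\<lambda>i J. (i, - int (fdim J), F J i)) ms Is"

text \<open>
  The output word of one summand of the lift.
\<close>

fun letters :: "(nat set \<Rightarrow> nat \<Rightarrow> 'a list \<Rightarrow> 'b) \<Rightarrow> nat list \<Rightarrow> nat set list \<Rightarrow> 'a word \<Rightarrow> 'b word" where
  "letters F (i # ms) (J # Is) w =
     (deg (take i w) - int (fdim J), F J i (map snd (take i w))) # letters F ms Is (drop i w)"
| "letters F _ _ w = []"

lemma letters_tensor_values:
  "length ms = length Is \<Longrightarrow> map snd (letters F ms Is w) = tensor_values (factors F ms Is) (map snd w)"
  "length ms = length Is \<Longrightarrow> length (letters F ms Is w) = length ms"
  by (induction ms Is arbitrary: w rule: list_induct2) (simp_all add: take_map drop_map)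

lemma sum_degrees_factors:
  "length ms = length Is \<Longrightarrow> (\<Sum>(i, d, f) \<leftarrow> factors F ms Is. d) = - (\<Sum>J\<leftarrow>Is. int (fdim J))"
  by (induction ms Is rule: list_induct2) simp_all

lemma lift_face_map:
  assumes "sorted_wrt (<) I" "\<And>J. J \<subseteq> set I \<Longrightarrow> J \<noteq> {} \<Longrightarrow> J \<in> K"
  shows "lift (face_map K F) g I w = (\<Sum>(ms, Is)\<in>decompositions (set I) (length w).
     signed (koszul (factors F ms Is) (map fst w)) (g (letters F ms Is w)))"
  using assms
proof (induction w arbitrary: g I rule: length_induct)
  case (1 w)
  have dist: "distinct I" using "1.prems"(1) by (simp add: strict_sorted_iff)
  show ?case
  proof (cases "w = []")
    case True
    then show ?thesis using distinct_card[OF dist] by (simp add: decompositions_def)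
  next
    case False
    then have pos: "0 < length w" by simp
    show ?thesis
      unfolding lift_coproduct[OF False] coproduct_def face_cut_sum_def cut_sum_def
        sum_decompositions[OF "1.prems"(1) pos]
    proof (intro sum.cong refl)
      fix i j assume ij: "i \<in> {..<length I}" "j \<in> {..<length w}"
      let ?J = "take (Suc i) I" and ?K = "drop i I" and ?u = "take (Suc j) w" and ?v = "drop (Suc j) w"
      have J: "face_map K F ?J ?u = F (set ?J) (Suc j) (map snd ?u)"
      proof -
        have "set ?J \<in> K" using ij set_take_subset[of "Suc i" I] by (intro "1.prems"(2)) auto
        moreover have "length ?u = Suc j" using ij by simp
        ultimately show ?thesis
          using "1.prems"(1) by (simp only: face_map_def word_map_def sorted_wrt_take if_True simp_thms)
      qed
      have fdJ: "ldim ?J = int (fdim (set ?J))"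
        using distinct_card[of ?J] dist ij by (simp add: fdim_def)
      have cardK: "int (card (set ?K)) - 1 = ldim ?K"
        using distinct_card[of ?K] dist by simp
      have "lift (face_map K F) (\<lambda>ys. g ((deg ?u - ldim ?J, face_map K F ?J ?u) # ys)) ?K ?v =
        (\<Sum>(ms, Is)\<in>decompositions (set ?K) (length ?v). signed (koszul (factors F ms Is) (map fst ?v))
           (g ((deg ?u - ldim ?J, face_map K F ?J ?u) # letters F ms Is ?v)))"
      proof (rule "1.IH"[rule_format])
        show "length ?v < length w" using ij by simp
        show "sorted_wrt (<) ?K" using "1.prems"(1) by (rule sorted_wrt_drop)
        show "J \<in> K" if "J \<subseteq> set ?K" "J \<noteq> {}" for J
          using that set_drop_subset[of i I] by (intro "1.prems"(2)) auto
      qed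
      then have "signed (ldim ?K * deg ?u)
          (lift (face_map K F) (\<lambda>ys. g ((deg ?u - ldim ?J, face_map K F ?J ?u) # ys)) ?K ?v) =
        (\<Sum>(ms, Is)\<in>decompositions (set ?K) (length w - Suc j).
          signed (ldim ?K * deg ?u) (signed (koszul (factors F ms Is) (map fst ?v))
            (g ((deg ?u - ldim ?J, face_map K F ?J ?u) # letters F ms Is ?v))))"
        by (simp only: signed_sum length_drop case_prod_unfold)
      also have "\<dots> = (\<Sum>(ms, Is)\<in>decompositions (set ?K) (length w - Suc j).
           signed (koszul (factors F (Suc j # ms) (set ?J # Is)) (map fst w))
             (g (letters F (Suc j # ms) (set ?J # Is) w)))"
      proof (intro sum.cong refl, clarify)
        fix ms Is assume D: "(ms, Is) \<in> decompositions (set ?K) (length w - Suc j)"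
        then have len: "length ms = length Is" and dim: "(\<Sum>J\<leftarrow>Is. int (fdim J)) = ldim ?K"
          using decompositions_fdim[OF finite_set D] cardK by auto
        have "letters F (Suc j # ms) (set ?J # Is) w
           = (deg ?u - ldim ?J, face_map K F ?J ?u) # letters F ms Is ?v"
          by (simp only: letters.simps J fdJ)
        moreover have "koszul (factors F (Suc j # ms) (set ?J # Is)) (map fst w)
           = - ldim ?K * deg ?u + koszul (factors F ms Is) (map fst ?v)"
          using sum_degrees_factors[OF len, of F] dim
          by (simp only: list.map zip_Cons_Cons prod.case koszul.simps deg_def take_map drop_map minus_mult_left)
        ultimately show "signed (ldim ?K * deg ?u) (signed (koszul (factors F ms Is) (map fst ?v))
            (g ((deg ?u - ldim ?J, face_map K F ?J ?u) # letters F ms Is ?v)))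
          = signed (koszul (factors F (Suc j # ms) (set ?J # Is)) (map fst w))
             (g (letters F (Suc j # ms) (set ?J # Is) w))"
          by (simp only: signed_signed) (rule signed_parity, simp)
      qed
      finally show "signed (ldim ?K * deg ?u)
          (lift (face_map K F) (\<lambda>ys. g ((deg ?u - ldim ?J, face_map K F ?J ?u) # ys)) ?K ?v) = \<dots>" .
    qed
  qed
qed

lemma face_boundary_eq:
  assumes "sorted_wrt (<) I" "j < length I"
  shows "face_boundary j (set I) = set (omit j I)"
proof -
  have "distinct I" "sorted_list_of_set (set I) = I"
    using assms(1) by (simp_all add: strict_sorted_iff sorted_list_of_set.idem_if_sorted_distinct)
  then show ?thesis by (simp only: face_boundary_def set_omit assms(2))
qed

lemma sorted_omit: "sorted_wrt (<) I \<Longrightarrow> sorted_wrt (<) (omit j I)" for I :: "nat list"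
proof (cases "j < length I")
  case True
  assume "sorted_wrt (<) I"
  then show ?thesis by (subst (asm) id_take_nth_drop[OF True]) (simp add: sorted_wrt_append)
qed simp

text \<open>
  The convention that a vertex has no boundary corresponds to the value 0 on the empty face.
\<close>

lemma defect_face_map:
  assumes I: "sorted_wrt (<) I" "I \<noteq> []" and K: "\<And>J. J \<subseteq> set I \<Longrightarrow> J \<noteq> {} \<Longrightarrow> J \<in> K" "{} \<notin> K"
    and "w \<noteq> []"
  shows "defect (word_map bA) (word_map bB) (face_map K F) I w =
    (if fdim (set I) = 0 then 0
       else \<Sum>j = 0..fdim (set I). signed (int j) (F (face_boundary j (set I)) (length w) (map snd w)))
    + signed (- int (fdim (set I))) (insertion_sum (F (set I)) bA (length w) (map fst w) (map snd w))
    - (\<Sum>(ms, Is) \<in> overlapping_decompositions (set I) (length w).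
             comp_tensor (bB (length ms)) (factors F ms Is) (map fst w) (map snd w))"
proof -
  have dist: "distinct I" using I(1) by (simp add: strict_sorted_iff)
  have len: "length I = Suc (fdim (set I))"
    using distinct_card[OF dist] I(2) by (simp add: fdim_def)
  have facets: "boundary_sum (\<lambda>J. face_map K F J w) I = (if fdim (set I) = 0 then 0
       else \<Sum>j = 0..fdim (set I). signed (int j) (F (face_boundary j (set I)) (length w) (map snd w)))"
  proof (cases "fdim (set I) = 0")
    case True
    then obtain v where "I = [v]" using len by (auto simp: length_Suc_conv)
    then show ?thesis using True K(2) by (simp add: face_map_def)
  next
    case False
    have "face_map K F (omit j I) w = F (face_boundary j (set I)) (length w) (map snd w)"
      if j: "j < length I" for j
    proof -
      let ?J = "omit j I"
      have "length ?J \<noteq> 0" using j len False by simp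
      then have "set ?J \<noteq> {}" by (metis length_0_conv set_empty)
      moreover have "set ?J \<subseteq> set I" using set_take_subset[of j I] set_drop_subset[of "Suc j" I] by auto
      ultimately have "set ?J \<in> K" by (intro K(1))
      then show ?thesis
        using sorted_omit[OF I(1), of j] face_boundary_eq[OF I(1) j]
        by (simp only: face_map_def word_map_def if_True simp_thms)
    qed
    then have "boundary_sum (\<lambda>J. face_map K F J w) I
      = (\<Sum>j<length I. signed (int j) (F (face_boundary j (set I)) (length w) (map snd w)))"
      unfolding boundary_sum_def by (intro sum.cong refl) simp
    moreover have "{..<length I} = {0..fdim (set I)}" using len by auto
    ultimately show ?thesis using False by simp
  qed
  have "face_map K F I = word_map (F (set I))"
    using I K(1)[of "set I"] by (simp add: face_map_def fun_eq_iff)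
  then have ins: "signed (ldim I) (codiff (word_map bA) (face_map K F I) w)
      = signed (- int (fdim (set I))) (insertion_sum (F (set I)) bA (length w) (map fst w) (map snd w))"
    unfolding insertion_sum_eq_codiff by (auto intro: signed_parity simp: len)
  have "lift (face_map K F) (word_map bB) I w = (\<Sum>(ms, Is)\<in>decompositions (set I) (length w).
       signed (koszul (factors F ms Is) (map fst w)) (word_map bB (letters F ms Is w)))"
    by (rule lift_face_map[OF I(1)]) (rule K(1))
  also have "\<dots> = (\<Sum>(ms, Is)\<in>decompositions (set I) (length w).
       comp_tensor (bB (length ms)) (factors F ms Is) (map fst w) (map snd w))"
  proof (rule sum.cong[OF refl])
    fix d assume d: "d \<in> decompositions (set I) (length w)"
    obtain ms Is where eq: "d = (ms, Is)" by (cases d)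
    from d have "length ms = length Is" unfolding eq by (rule decompositions_fdim(1)[OF finite_set])
    then show "(case d of (ms, Is) \<Rightarrow>
         signed (koszul (factors F ms Is) (map fst w)) (word_map bB (letters F ms Is w)))
       = (case d of (ms, Is) \<Rightarrow>
         comp_tensor (bB (length ms)) (factors F ms Is) (map fst w) (map snd w))"
      by (simp only: eq prod.case comp_tensor_def word_map_def letters_tensor_values)
  qed
  finally have lift: "lift (face_map K F) (word_map bB) I w = \<dots>" .
  have "decompositions (set I) (length w) = overlapping_decompositions (set I) (length w)"
    using assms(5) by (simp add: decompositions_def)
  then show ?thesis by (simp only: defect_def total_codiff_def facets ins lift)
qed

lemma homogeneous_iff_homogeneous_word:
  "homogeneous V ps xs \<longleftrightarrow> (\<exists>w. ps = map fst w \<and> xs = map snd w \<and> homogeneous_word V w)"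
proof
  assume "homogeneous V ps xs"
  then have "list_all2 (\<lambda>p x. x \<in> V p) ps xs" by (simp add: homogeneous_def)
  then have "ps = map fst (zip ps xs) \<and> xs = map snd (zip ps xs) \<and> homogeneous_word V (zip ps xs)"
    by (auto simp: homogeneous_word_def list_all2_iff)
  then show "\<exists>w. ps = map fst w \<and> xs = map snd w \<and> homogeneous_word V w" by blast
qed (auto simp: homogeneous_def homogeneous_word_def list_all2_iff zip_map_fst_snd)

lemma morphism_equation_iff_defect:
  assumes "sorted_wrt (<) I" "I \<noteq> []" "\<And>J. J \<subseteq> set I \<Longrightarrow> J \<noteq> {} \<Longrightarrow> J \<in> K" "{} \<notin> K" "1 \<le> m"
  shows "morphism_equation A bA bB F (set I) m \<longleftrightarrow> (\<forall>w. length w = m \<longrightarrow> homogeneous_word (shift A) w \<longrightarrow>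
     defect (word_map bA) (word_map bB) (face_map K F) I w = 0)"
proof -
  let ?eq = "\<lambda>m ps xs. (if fdim (set I) = 0 then 0
       else \<Sum>j = 0..fdim (set I). signed (int j) (F (face_boundary j (set I)) m xs))
    + signed (- int (fdim (set I))) (insertion_sum (F (set I)) bA m ps xs)
    = (\<Sum>(ms, Is) \<in> overlapping_decompositions (set I) m.
         comp_tensor (bB (length ms)) (factors F ms Is) ps xs)"
  have eq: "defect (word_map bA) (word_map bB) (face_map K F) I w = 0
      \<longleftrightarrow> ?eq (length w) (map fst w) (map snd w)" if "w \<noteq> []" for w
    by (subst right_minus_eq[symmetric], rule arg_cong[where f = "\<lambda>x. x = 0"],
        rule defect_face_map[OF assms(1,2) _ assms(4) that]) (rule assms(3))
  show ?thesis
    unfolding morphism_equation_def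
  proof (intro iffI allI impI)
    fix w assume *: "\<forall>ps xs. length xs = m \<longrightarrow> homogeneous (shift A) ps xs \<longrightarrow> ?eq m ps xs"
      and w: "length w = m" "homogeneous_word (shift A) w"
    have ne: "w \<noteq> []" and "length (map snd w) = m" using w(1) assms(5) by auto
    moreover have "homogeneous (shift A) (map fst w) (map snd w)"
      using w(2) unfolding homogeneous_iff_homogeneous_word by blast
    ultimately have "?eq m (map fst w) (map snd w)" using * by blast
    then show "defect (word_map bA) (word_map bB) (face_map K F) I w = 0"
      unfolding eq[OF ne] w(1) .
  next
    fix ps xs
    assume *: "\<forall>w. length w = m \<longrightarrow> homogeneous_word (shift A) w \<longrightarrow>
        defect (word_map bA) (word_map bB) (face_map K F) I w = 0"
      and xs: "length xs = m" "homogeneous (shift A) ps xs"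
    from xs(2) obtain w where w: "ps = map fst w" "xs = map snd w" "homogeneous_word (shift A) w"
      unfolding homogeneous_iff_homogeneous_word by blast
    have len: "length w = m" and ne: "w \<noteq> []" using xs(1) w(2) assms(5) by auto
    have "defect (word_map bA) (word_map bB) (face_map K F) I w = 0" using * len w(3) by blast
    then show "?eq m ps xs" unfolding eq[OF ne] w(1,2) len .
  qed
qed

text \<open>
  The equation of a face concerns its subfaces only. Taking these as the set of faces makes the two face
  maps equal.
\<close>

lemma morphism_equation_cong:
  assumes "finite I" "I \<noteq> {}" "1 \<le> m" and FG: "\<And>J. J \<subseteq> I \<Longrightarrow> J \<noteq> {} \<Longrightarrow> F J = G J"
  shows "morphism_equation A bA bB F I m \<longleftrightarrow> morphism_equation A bA bB G I m"
proof -
  let ?L = "sorted_list_of_set I" and ?K = "{J. J \<subseteq> I \<and> J \<noteq> {}}"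
  have L: "sorted_wrt (<) ?L" "?L \<noteq> []" "set ?L = I"
    using assms(1,2) by simp_all
  have "face_map ?K F = face_map ?K G"
    using FG by (auto simp: face_map_def word_map_def fun_eq_iff)
  then show ?thesis
    using morphism_equation_iff_defect[OF L(1,2), of ?K m A bA bB F]
      morphism_equation_iff_defect[OF L(1,2), of ?K m A bA bB G] L(3) assms(3) by simp
qed


section \<open>Multilinear extension from homogeneous elements\<close>

lemma graded_module_shift:
  fixes A :: "int \<Rightarrow> 'a::ab_group_add set"
  assumes "graded_module A"
  shows "graded_module (shift A)"
proof -
  interpret graded_module A by fact
  show ?thesis
  proof
    fix x :: 'a
    let ?P = "\<lambda>A c. (\<forall>i. c i \<in> A i) \<and> finite {i. c i \<noteq> 0} \<and> x = (\<Sum>i | c i \<noteq> 0. c i)"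
    have trans: "?P (\<lambda>i. A (i + e)) (\<lambda>i. c (i + e))" if "?P A c" for A c and e :: int
    proof -
      have eq: "{i. c i \<noteq> 0} = (\<lambda>i. i + e) ` {i. c (i + e) \<noteq> 0}"
        by (auto simp: image_iff) (metis diff_add_cancel)
      moreover have "inj_on (\<lambda>i. i + e) S" for S by simp
      ultimately show ?thesis
        using that by (simp add: finite_image_iff sum.reindex)
    qed
    obtain c where c: "?P A c" "\<And>d. ?P A d \<Longrightarrow> d = c"
      using direct_sum[of x] by (elim ex1E) blast
    show "\<exists>!c. ?P (shift A) c"
    proof (rule ex1I)
      show "?P (shift A) (\<lambda>i. c (i + 1))"
        using trans[OF c(1), of 1] unfolding shift_def by blast
      fix d assume "?P (shift A) d"
      from trans[OF this, of "-1"] have "(\<lambda>i. d (i - 1)) = c"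
        by (intro c(2)) (simp add: shift_def)
      then show "d = (\<lambda>i. c (i + 1))" by (metis add_diff_cancel_right')
    qed
  qed (simp_all add: shift_def zero_mem add_mem uminus_mem)
qed

context graded_module
begin

definition component :: "'a \<Rightarrow> int \<Rightarrow> 'a" where
  "component x = (THE c. (\<forall>i. c i \<in> A i) \<and> finite {i. c i \<noteq> 0} \<and> x = (\<Sum>i | c i \<noteq> 0. c i))"

lemma component_mem: "component x i \<in> A i"
  and finite_component: "finite {i. component x i \<noteq> 0}"
  and sum_component: "(\<Sum>i | component x i \<noteq> 0. component x i) = x"
  using theI'[OF direct_sum[of x]] unfolding component_def by auto

lemma component_unique:
  assumes "\<And>i. c i \<in> A i" "finite {i. c i \<noteq> 0}" "x = (\<Sum>i | c i \<noteq> 0. c i)"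
  shows "component x = c"
  unfolding component_def using assms by (intro the1_equality[OF direct_sum]) auto

lemma component_add: "component (x + y) i = component x i + component y i"
proof -
  let ?S = "{i. component x i \<noteq> 0} \<union> {i. component y i \<noteq> 0}"
  let ?c = "\<lambda>i. component x i + component y i"
  have fin: "finite ?S" using finite_component by simp
  have sub: "{i. ?c i \<noteq> 0} \<subseteq> ?S" by auto
  have "(\<Sum>i | ?c i \<noteq> 0. ?c i) = (\<Sum>i\<in>?S. ?c i)"
    using fin sub by (intro sum.mono_neutral_left) auto
  also have "\<dots> = (\<Sum>i\<in>?S. component x i) + (\<Sum>i\<in>?S. component y i)" by (rule sum.distrib)
  also have "(\<Sum>i\<in>?S. component x i) = (\<Sum>i | component x i \<noteq> 0. component x i)"
    using fin by (intro sum.mono_neutral_right) auto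
  also have "(\<Sum>i\<in>?S. component y i) = (\<Sum>i | component y i \<noteq> 0. component y i)"
    using fin by (intro sum.mono_neutral_right) auto
  finally have "x + y = (\<Sum>i | ?c i \<noteq> 0. ?c i)" by (simp add: sum_component)
  then have "component (x + y) = ?c"
    using finite_subset[OF sub fin] by (intro component_unique add_mem component_mem) auto
  then show ?thesis by simp
qed

lemma component_homogeneous:
  assumes "x \<in> A p"
  shows "component x = (\<lambda>i. if i = p then x else 0)"
proof -
  have "{i. (if i = p then x else 0) \<noteq> 0} = (if x = 0 then {} else {p})" by auto
  then show ?thesis using assms by (intro component_unique) (auto simp: zero_mem)
qed

text \<open>
  One argument after another is split into homogeneous components.
\<close>

lemma multilinear_ext:
  fixes f g :: "'a list \<Rightarrow> 'c::ab_group_add"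
  assumes "multilinear m f" "multilinear m g"
    and hom: "\<And>w. length w = m \<Longrightarrow> homogeneous_word A w \<Longrightarrow> f (map snd w) = g (map snd w)"
    and "length xs = m"
  shows "f xs = g xs"
proof -
  have "f (map snd w @ xs) = g (map snd w @ xs)" if "length w + length xs = m" "homogeneous_word A w" for w xs
    using that
  proof (induction xs arbitrary: w)
    case Nil
    then show ?case using hom by simp
  next
    case (Cons x xs)
    have add: "additive (\<lambda>y. h (map snd w @ y # xs))" if "multilinear m h" for h :: "'a list \<Rightarrow> 'c"
      using that Cons.prems(1) unfolding additive_def multilinear_def by auto
    have x: "h (map snd w @ x # xs) = (\<Sum>i | component x i \<noteq> 0. h (map snd w @ component x i # xs))"
      if "multilinear m h" for h :: "'a list \<Rightarrow> 'c"
      using additive.sum[OF add[OF that], of "component x" "{i. component x i \<noteq> 0}"]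
      by (simp only: sum_component)
    have "f (map snd w @ component x i # xs) = g (map snd w @ component x i # xs)" for i
      using Cons.IH[of "w @ [(i, component x i)]"] Cons.prems by (simp add: component_mem)
    then show ?case by (simp add: x[OF assms(1)] x[OF assms(2)])
  qed
  from this[of "[]" xs] show ?thesis using assms(4) by simp
qed

text \<open>
  The value is the sum of \<open>G\<close> over all choices of homogeneous components of the arguments. The degrees of
  the chosen components are the labels of the word, so signs in \<open>G\<close> may depend on them.
\<close>

lemma multilinear_extension:
  fixes G :: "'a word \<Rightarrow> 'c::ab_group_add"
  assumes G: "multiadditive G"
  obtains f where "f \<in> extensional {xs. length xs = m}" "multilinear m f"
    "\<And>w. length w = m \<Longrightarrow> homogeneous_word A w \<Longrightarrow> f (map snd w) = G w"
proof -
  define c where "c ps xs = map2 (\<lambda>p x. (p, component x p)) ps xs" for ps xs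
  define h where "h xs ps = (if length ps = length xs then G (c ps xs) else 0)" for xs ps
  have G0: "G w = 0" if "(p, 0) \<in> set w" for p w
  proof -
    from that obtain u v where "w = u @ (p, 0) # v" by (meson split_list)
    then show ?thesis using additive.zero[OF multiadditive_additive[OF G]] by simp
  qed
  have c_nth: "c ps xs ! i = (ps ! i, component (xs ! i) (ps ! i))" "i < length (c ps xs)"
    if "length ps = length xs" "i < length xs" for ps xs i
    using that by (simp_all add: c_def)
  have supp: "component (xs ! i) (ps ! i) \<noteq> 0" if "h xs ps \<noteq> 0" "i < length xs" for xs ps i
  proof
    assume "component (xs ! i) (ps ! i) = 0"
    moreover have len: "length ps = length xs" using that(1) by (auto simp: h_def split: if_splits)
    ultimately have "(ps ! i, 0) \<in> set (c ps xs)"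
      using c_nth[OF len that(2)] by (metis nth_mem)
    then show False using G0 that(1) len by (simp add: h_def)
  qed
  have fin: "finite {ps. h xs ps \<noteq> 0}" for xs
  proof (rule finite_subset)
    let ?S = "\<Union>x\<in>set xs. {p. component x p \<noteq> 0}"
    show "finite {ps. set ps \<subseteq> ?S \<and> length ps = length xs}"
      by (intro finite_lists_length_eq) (simp add: finite_component)
    show "{ps. h xs ps \<noteq> 0} \<subseteq> {ps. set ps \<subseteq> ?S \<and> length ps = length xs}"
    proof clarify
      fix ps assume h: "h xs ps \<noteq> 0"
      then have len: "length ps = length xs" by (auto simp: h_def split: if_splits)
      then show "set ps \<subseteq> ?S \<and> length ps = length xs"
        using supp[OF h] by (auto simp: in_set_conv_nth) (metis nth_mem)
    qed
  qed
  have h_add: "h (xs @ (x + y) # ys) ps = h (xs @ x # ys) ps + h (xs @ y # ys) ps" for xs x y ys ps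
  proof (cases "length ps = length xs + 1 + length ys")
    case True
    then obtain p qs where ps: "drop (length xs) ps = p # qs"
      by (cases "drop (length xs) ps") auto
    have "c ps (xs @ z # ys) = c (take (length xs) ps) xs @ (p, component z p) # c qs ys" for z
    proof -
      have "ps = take (length xs) ps @ p # qs" by (metis append_take_drop_id ps)
      then have "c ps (xs @ z # ys) = c (take (length xs) ps @ p # qs) (xs @ z # ys)" by simp
      then show ?thesis using True by (simp add: c_def)
    qed
    then show ?thesis using True by (simp add: h_def component_add multiadditiveD[OF G])
  qed (simp add: h_def)
  let ?f = "restrict (\<lambda>xs. Sum_any (h xs)) {xs. length xs = m}"
  show ?thesis
  proof
    show "?f \<in> extensional {xs. length xs = m}" by simp
    show "multilinear m ?f"
      unfolding multilinear_def by (simp add: h_add[abs_def] Sum_any.distrib fin)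
    fix w :: "'a word" assume w: "length w = m" "homogeneous_word A w"
    have "h (map snd w) ps = (if ps = map fst w then G w else 0)" for ps
    proof (cases "ps = map fst w")
      case True
      have "c (map fst w) (map snd w) = w"
        using w(2) unfolding c_def
        by (induction w) (auto simp: component_homogeneous)
      with True show ?thesis by (simp add: h_def)
    next
      case False
      have "h (map snd w) ps = 0"
      proof (rule ccontr)
        assume h: "h (map snd w) ps \<noteq> 0"
        then have len: "length ps = length w" by (auto simp: h_def split: if_splits)
        have "ps ! i = map fst w ! i" if "i < length w" for i
        proof (rule ccontr)
          assume "ps ! i \<noteq> map fst w ! i"
          moreover have "snd (w ! i) \<in> A (fst (w ! i))"
            using w(2) that by (auto simp: homogeneous_word_def dest: nth_mem split: prod.splits)
          ultimately have "component (map snd w ! i) (ps ! i) = 0"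
            using that by (simp add: component_homogeneous)
          with supp[OF h] that show False by simp
        qed
        then have "ps = map fst w" using len by (intro nth_equalityI) auto
        with False show False ..
      qed
      with False show ?thesis by simp
    qed
    then have "h (map snd w) = (\<lambda>ps. if ps = map fst w then G w else 0)" by (rule ext)
    then show "?f (map snd w) = G w"
      using w(1) by (simp add: Sum_any.delta)
  qed
qed

end


section \<open>Inner facets\<close>

lemma omit_neq:
  assumes "distinct I" "j < length I" "k < length I" "j \<noteq> k"
  shows "omit j I \<noteq> omit k I"
proof
  assume "omit j I = omit k I"
  then have "set I - {I ! j} = set I - {I ! k}" using set_omit assms by metis
  moreover have "I ! j \<noteq> I ! k" using assms by (simp add: nth_eq_iff_index_eq)
  ultimately show False using assms(2) nth_mem by blast
qed

text \<open>
  An inner facet contains the first and the last vertex, so the only segment containing it is the whole face.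
\<close>

lemma segment_neq_omit:
  assumes "distinct I" "0 < k" "Suc k < length I" "L @ J @ M = I"
  shows "J \<noteq> omit k I"
proof
  assume J: "J = omit k I"
  have set: "set J = set I - {I ! k}"
    unfolding J by (rule set_omit) (use assms in simp_all)
  have inj: "I ! a \<noteq> I ! b" if "a < length I" "b < length I" "a \<noteq> b" for a b
    using assms(1) that by (simp add: nth_eq_iff_index_eq)
  have "I \<noteq> []" using assms(3) by auto
  then have "I ! 0 \<in> set J" "I ! (length I - 1) \<in> set J"
    unfolding set using assms(2,3) inj[of 0 k] inj[of "length I - 1" k] nth_mem[of 0 I] nth_mem[of "length I - 1" I]
    by (simp_all del: nth_mem)
  then have "hd I \<in> set J" "last I \<in> set J"
    using \<open>I \<noteq> []\<close> by (simp_all add: hd_conv_nth last_conv_nth)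
  moreover have "distinct (L @ J @ M)" using assms(1,4) by simp
  moreover have "hd I \<in> set L" if "L \<noteq> []" using that unfolding assms(4)[symmetric] by simp
  moreover have "last I \<in> set M" if "M \<noteq> []" using that unfolding assms(4)[symmetric] by simp
  ultimately have "L = []" "M = []" by auto
  then have "J = I" using assms(4) by simp
  moreover have "I ! k \<notin> set J" unfolding set by simp
  moreover have "I ! k \<in> set I" using assms(3) by simp
  ultimately show False by blast
qed

lemma sum_single:
  assumes "finite S" "k \<in> S" "\<And>j. j \<in> S \<Longrightarrow> j \<noteq> k \<Longrightarrow> f j = 0"
  shows "sum f S = f k"
  using assms by (subst sum.remove[OF assms(1,2)]) auto

text \<open>
  The inner facet \<open>omit k I\<close> enters the equation of \<open>I\<close> through the boundary alone, with coefficient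
  \<open>(-1)\<^sup>k\<close>. This is the source of both uniqueness and existence of fillers.
\<close>

lemma defect_omit:
  assumes "distinct I" "0 < k" "Suc k < length I" and FG: "\<And>J. J \<noteq> omit k I \<Longrightarrow> F J = G J"
  shows "defect bA bB F I w = defect bA bB G I w + signed (int k) (F (omit k I) w - G (omit k I) w)"
proof -
  have FI: "F I = G I"
    using segment_neq_omit[OF assms(1-3), of "[]" I "[]"] by (intro FG) simp
  have "lift F bB I w = lift G bB I w"
    using segment_neq_omit[OF assms(1-3)] by (intro lift_cong_map) (simp add: FG)
  moreover have "boundary_sum (\<lambda>J. F J w) I - boundary_sum (\<lambda>J. G J w) I = signed (int k) (F (omit k I) w - G (omit k I) w)"
    unfolding boundary_sum_diff[symmetric] unfolding boundary_sum_def
  proof (rule sum_single)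
    fix j assume "j \<in> {..<length I}" "j \<noteq> k"
    then have "omit j I \<noteq> omit k I" using assms(1,3) by (intro omit_neq) auto
    then show "signed (int j) (F (omit j I) w - G (omit j I) w) = 0" by (simp add: FG)
  qed (use assms(3) in auto)
  ultimately show ?thesis
    by (simp add: defect_def total_codiff_def FI algebra_simps)
qed

text \<open>
  In the Bianchi identity for \<open>I\<close>, the insertion terms contain the defect on segments, and the total
  differential contains it on \<open>I\<close> and on the facets. If all these vanish except possibly the one on
  \<open>omit k I\<close>, then so does the latter.
\<close>

lemma defect_omit_eq_0:
  assumes I: "distinct I" "0 < k" "Suc k < length I"
    and F: "\<And>J. multiadditive (F J)" "\<And>u. F [] u = 0" and "multiadditive bB"
    and A: "\<And>v. homogeneous_word V v \<Longrightarrow> codiff bA bA v = 0" "\<And>v. homogeneous_word V v \<Longrightarrow> v \<noteq> [] \<Longrightarrow> bA v \<in> V (deg v + 1)"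
    and B: "lift F (codiff bB bB) I w = 0"
    and w: "homogeneous_word V w" "w \<noteq> []"
    and segment: "\<And>L J M u. L @ J @ M = I \<Longrightarrow> J \<noteq> [] \<Longrightarrow> homogeneous_word V u \<Longrightarrow> u \<noteq> [] \<Longrightarrow> defect bA bB F J u = 0"
    and facet: "\<And>j. j < length I \<Longrightarrow> j \<noteq> k \<Longrightarrow> defect bA bB F (omit j I) w = 0"
  shows "defect bA bB F (omit k I) w = 0"
proof -
  let ?E = "defect bA bB F"
  have sub: "homogeneous_word V v" if "u @ v @ t = w" for u v t using w(1) that by auto
  have "codiff bA (?E I) w = codiff bA (\<lambda>_. 0) w"
  proof (rule codiff_cong)
    fix u v t assume *: "u @ v @ t = w" "v \<noteq> []"
    have "homogeneous_word V (u @ (deg v + 1, bA v) # t)" using w(1) * A(2)[of v] by auto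
    then show "?E I (u @ (deg v + 1, bA v) # t) = 0"
      using I(3) by (intro segment[of "[]" I "[]"]) auto
  qed
  then have "total_codiff bA ?E I w = boundary_sum (\<lambda>J. ?E J w) I"
    by (simp add: total_codiff_def codiff_zero)
  also have "\<dots> = signed (int k) (?E (omit k I) w)"
    unfolding boundary_sum_def by (rule sum_single) (use I(3) facet in auto)
  finally have "signed (int k) (?E (omit k I) w) = - lift_insert F ?E bB I w"
    using total_codiff_defect[OF F assms(6) A(1)[OF sub] B] by simp
  also have "lift_insert F ?E bB I w = 0"
    using w(1) by (intro lift_insert_eq_0[OF assms(6)]) (auto intro: segment)
  finally show ?thesis by (simp add: signed_def split: if_splits)
qed


section \<open>Structure maps and graded families\<close>

lemma multiadditive_word_map:
  assumes "\<And>m. 1 \<le> m \<Longrightarrow> multilinear m (f m)"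
  shows "multiadditive (word_map f)"
  unfolding multiadditive_def
proof (intro allI)
  fix u v p x y
  show "word_map f (u @ (p, x + y) # v) = word_map f (u @ (p, x) # v) + word_map f (u @ (p, y) # v)"
    using assms[of "Suc (length u + length v)"]
    unfolding multilinear_def word_map_def by simp
qed

context A_infinity_algebra
begin

lemma multiadditive_b: "multiadditive (word_map b)"
  using b_maps by (intro multiadditive_word_map) (auto simp: graded_maps_def)

lemma b_mem:
  assumes "homogeneous_word (shift A) w" "w \<noteq> []"
  shows "word_map b w \<in> shift A (deg w + 1)"
proof -
  have "b (length w) \<in> graded_maps (shift A) (shift A) (length w) 1"
    using assms(2) by (intro b_maps) (simp add: Suc_le_eq)
  moreover have "homogeneous (shift A) (map fst w) (map snd w)"
    using assms(1) unfolding homogeneous_iff_homogeneous_word by blast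
  ultimately show ?thesis unfolding graded_maps_def word_map_def deg_def by auto
qed

lemma codiff_b:
  assumes "homogeneous_word (shift A) w"
  shows "codiff (word_map b) (word_map b) w = 0"
proof (cases "w = []")
  case False
  have "homogeneous (shift A) (map fst w) (map snd w)"
    using assms(1) unfolding homogeneous_iff_homogeneous_word by blast
  then show ?thesis
    using A_infinity_relation[of "length w" "map snd w" "map fst w"] False
    by (simp add: insertion_sum_eq_codiff Suc_le_eq)
qed simp

end

lemma subgroup_set_graded: "graded_module A \<Longrightarrow> subgroup_set (A i)"
  unfolding subgroup_set_def graded_module_def by blast

definition graded_family ::
  "(int \<Rightarrow> 'a::ab_group_add set) \<Rightarrow> (int \<Rightarrow> 'b::ab_group_add set) \<Rightarrow> nat set set \<Rightarrow>
    (nat set \<Rightarrow> nat \<Rightarrow> 'a list \<Rightarrow> 'b) \<Rightarrow> bool" where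
  "graded_family V W K F \<longleftrightarrow> (\<forall>I\<in>K. \<forall>m\<ge>1. multilinear m (F I m) \<and>
     (\<forall>w. length w = m \<longrightarrow> homogeneous_word V w \<longrightarrow> F I m (map snd w) \<in> W (deg w - int (fdim I))))"

lemma graded_maps_homogeneous_word:
  "f \<in> graded_maps V W m d \<longleftrightarrow> f \<in> extensional {xs. length xs = m} \<and> multilinear m f \<and>
     (\<forall>w. length w = m \<longrightarrow> homogeneous_word V w \<longrightarrow> f (map snd w) \<in> W (deg w + d))"
proof -
  have "(\<forall>ps xs. length xs = m \<longrightarrow> homogeneous V ps xs \<longrightarrow> f xs \<in> W (sum_list ps + d)) \<longleftrightarrow>
      (\<forall>w. length w = m \<longrightarrow> homogeneous_word V w \<longrightarrow> f (map snd w) \<in> W (deg w + d))"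
    unfolding homogeneous_iff_homogeneous_word deg_def by (metis length_map)
  then show ?thesis unfolding graded_maps_def by blast
qed

lemma multiadditive_face_map:
  "graded_family V W K F \<Longrightarrow> multiadditive (face_map K F J)"
  using multiadditive_word_map[of "F (set J)"]
  by (auto simp: graded_family_def face_map_def multiadditive_def)

lemma face_map_mem:
  assumes "graded_family V W K F" "\<And>p. subgroup_set (W p)" "homogeneous_word V u" "u \<noteq> []" "{} \<notin> K"
  shows "face_map K F J u \<in> W (deg u - ldim J)"
proof (cases "sorted_wrt (<) J \<and> set J \<in> K")
  case True
  then have "distinct J" "J \<noteq> []" using assms(5) by (auto simp: strict_sorted_iff)
  then have "ldim J = int (fdim (set J))"
    using distinct_card[of J] by (cases J) (auto simp: fdim_def)
  moreover have "1 \<le> length u" using assms(4) by (simp add: Suc_le_eq)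
  ultimately show ?thesis
    using assms(1,3) True unfolding graded_family_def face_map_def word_map_def by auto
next
  case False
  then show ?thesis
    unfolding face_map_def using subgroup_setD(1)[OF assms(2)] by (simp only: if_False)
qed

lemma boundary_sum_mem: "subgroup_set S \<Longrightarrow> (\<And>j. j < length I \<Longrightarrow> \<phi> (omit j I) \<in> S) \<Longrightarrow> boundary_sum \<phi> I \<in> S"
  unfolding boundary_sum_def by (intro subgroup_set_sum subgroup_setD) auto

lemma defect_mem:
  assumes W: "\<And>p. subgroup_set (W p)"
    and F: "\<And>J u. homogeneous_word V u \<Longrightarrow> u \<noteq> [] \<Longrightarrow> F J u \<in> W (deg u - ldim J)"
    and bA: "\<And>v. homogeneous_word V v \<Longrightarrow> v \<noteq> [] \<Longrightarrow> bA v \<in> V (deg v + 1)"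
    and bB: "\<And>v. homogeneous_word W v \<Longrightarrow> v \<noteq> [] \<Longrightarrow> bB v \<in> W (deg v + 1)"
    and w: "homogeneous_word V w" "w \<noteq> []"
  shows "defect bA bB F I w \<in> W (deg w - ldim I + 1)"
proof -
  have "boundary_sum (\<lambda>J. F J w) I \<in> W (deg w - ldim I + 1)"
  proof (rule boundary_sum_mem[OF W])
    fix j assume "j < length I"
    then have "deg w - ldim (omit j I) = deg w - ldim I + 1" by auto
    with F[OF w] show "F (omit j I) w \<in> W (deg w - ldim I + 1)" by metis
  qed
  moreover have "codiff bA (F I) w \<in> W (deg w - ldim I + 1)"
  proof (rule codiff_mem[OF W])
    fix u v t assume *: "u @ v @ t = w" "v \<noteq> []"
    have "homogeneous_word V (u @ (deg v + 1, bA v) # t)" using w(1) * bA[of v] by auto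
    then have "F I (u @ (deg v + 1, bA v) # t) \<in> W (deg (u @ (deg v + 1, bA v) # t) - ldim I)"
      by (intro F) auto
    moreover have "deg (u @ (deg v + 1, bA v) # t) - ldim I = deg w - ldim I + 1" using * by auto
    ultimately show "F I (u @ (deg v + 1, bA v) # t) \<in> W (deg w - ldim I + 1)" by metis
  qed
  moreover have "lift F bB I w \<in> W (deg w - ldim I + 1)"
  proof (rule lift_mem[where V = V and W = W])
    show "homogeneous_word V w" by (rule w)
    show "subgroup_set (W (deg w - ldim I + 1))" by (rule W)
    show "F J u \<in> W (deg u - ldim J)" if "homogeneous_word V u" "u \<noteq> []" for J u using that by (rule F)
    fix ys assume ys: "homogeneous_word W ys" "deg ys = deg w - ldim I" "ys = [] \<Longrightarrow> w = []"
    have "bB ys \<in> W (deg ys + 1)" using ys w(2) by (intro bB) auto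
    then show "bB ys \<in> W (deg w - ldim I + 1)" by (simp only: ys(2))
  qed
  ultimately show ?thesis
    unfolding defect_def total_codiff_def by (intro subgroup_setD[OF W])
qed


section \<open>Fillers of inner horns\<close>

lemma HOM_on_iff:
  "F \<in> HOM_on A bA B bB K \<longleftrightarrow>
     F \<in> (\<Pi>\<^sub>E I \<in> K. \<Pi>\<^sub>E m \<in> {1..}. graded_maps (shift A) (shift B) m (- int (fdim I))) \<and>
     (\<forall>I \<in> K. \<forall>m \<ge> 1. morphism_equation A bA bB F I m)"
  by (simp add: HOM_on_def)

theorem proposition11:
  fixes A :: "int \<Rightarrow> 'a::ab_group_add set" and bA :: "nat \<Rightarrow> 'a list \<Rightarrow> 'a"
    and B :: "int \<Rightarrow> 'b::ab_group_add set" and bB :: "nat \<Rightarrow> 'b list \<Rightarrow> 'b"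
    and n k :: nat
    and H :: "nat set \<Rightarrow> nat \<Rightarrow> 'a list \<Rightarrow> 'b"
  assumes "A_infinity_algebra A bA"
    and "A_infinity_algebra B bB"
    and "2 \<le> n" and "0 < k" and "k < n"
    and "H \<in> horns A bA B bB k n"
  shows "bij_betw (\<lambda>F. F {0..n}) (horn_fillers A bA B bB k n H)
           (\<Pi>\<^sub>E m \<in> {1..}. graded_maps (shift A) (shift B) m (- int n))"
proof -
  interpret A: A_infinity_algebra A bA by fact
  interpret B: A_infinity_algebra B bB by fact
  interpret sA: graded_module "shift A"
    by (rule graded_module_shift) (rule A.graded_module_axioms)
  have W: "subgroup_set (shift B p)" for p
    unfolding shift_def by (rule subgroup_set_graded) (rule B.graded_module_axioms)
  define K where "K = faces n"
  define I where "I = [0..<Suc n]"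
  define top where "top = {0..n}"
  define D where "D = {0..n} - {k}"
  let ?bA = "word_map bA" and ?bB = "word_map bB"
  let ?E = "\<lambda>F. defect ?bA ?bB (face_map K F)"
  have I: "sorted_wrt (<) I" "I \<noteq> []" "distinct I" "set I = top" "length I = Suc n" "Suc k < length I"
    using assms(5) by (auto simp: I_def top_def strict_sorted_iff simp del: upt_Suc)
  have "I ! k = k" using assms(5) nth_upt[of 0 k "Suc n"] by (simp add: I_def del: upt_Suc)
  moreover have "set (omit k I) = set I - {I ! k}" by (rule set_omit[OF I(3)]) (use I(6) in simp)
  ultimately have omit: "set (omit k I) = D" "sorted_wrt (<) (omit k I)"
    using sorted_omit[OF I(1)] by (simp_all only: I(4) D_def top_def)
  have top: "top \<in> K" "fdim top = n" by (auto simp: K_def faces_def top_def fdim_def)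
  have D: "D \<in> K" "D \<noteq> top" "int (fdim D) = int n - 1"
  proof -
    have "card D = n" using assms(5) by (simp add: D_def)
    then show "int (fdim D) = int n - 1" using assms(3) by (simp add: fdim_def)
    have "0 \<in> D" using assms(4) by (simp add: D_def)
    moreover have "D \<subseteq> {0..n}" unfolding D_def by (rule Diff_subset)
    ultimately show "D \<in> K" unfolding K_def faces_def by blast
    have "k \<notin> D" "k \<in> top" using assms(5) by (simp_all add: D_def top_def)
    then show "D \<noteq> top" by blast
  qed
  have horn: "horn_faces k n = K - {top, D}" by (simp add: horn_faces_def K_def top_def D_def)
  have horn_sub: "J \<in> K - {top, D}" if "J' \<in> K - {top, D}" "J \<subseteq> J'" "J \<noteq> {}" for J J'
    using that by (auto simp: K_def faces_def top_def D_def)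
  have K: "J \<in> K \<longleftrightarrow> J \<subseteq> top \<and> J \<noteq> {}" for J by (auto simp: K_def faces_def top_def)
  have finK: "finite J" if "J \<in> K" for J using that K[of J] by (auto simp: top_def intro: finite_subset)
  have H: "H \<in> (\<Pi>\<^sub>E J \<in> K - {top, D}. \<Pi>\<^sub>E m \<in> {1..}. graded_maps (shift A) (shift B) m (- int (fdim J)))"
    "\<And>J m. J \<in> K - {top, D} \<Longrightarrow> 1 \<le> m \<Longrightarrow> morphism_equation A bA bB H J m"
    using assms(6) by (auto simp: horns_def HOM_on_iff horn)
  \<comment> \<open>The horn together with a prescribed value on the top face, and 0 on the missing facet.\<close>
  define H' where "H' T = H(top := T, D := (\<lambda>m xs. 0))" for T
  have fam_H': "graded_family (shift A) (shift B) K (H' T)"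
    if "T \<in> (\<Pi>\<^sub>E m \<in> {1..}. graded_maps (shift A) (shift B) m (- int n))" for T
    unfolding graded_family_def
  proof (intro ballI allI impI)
    fix J and m :: nat assume J: "J \<in> K" and m: "1 \<le> m"
    consider "J = D" | "J = top" "J \<noteq> D" | "J \<in> K - {top, D}" using J by blast
    then show "multilinear m (H' T J m) \<and> (\<forall>w. length w = m \<longrightarrow> homogeneous_word (shift A) w \<longrightarrow>
       H' T J m (map snd w) \<in> shift B (deg w - int (fdim J)))"
    proof cases
      case 1
      then show ?thesis using subgroup_setD(1)[OF W] by (simp add: H'_def multilinear_def)
    next
      case 2
      then have "H' T J m = T m" by (simp add: H'_def)
      moreover have "T m \<in> graded_maps (shift A) (shift B) m (- int n)" using that m by auto
      ultimately show ?thesis using 2 top(2) by (simp add: graded_maps_homogeneous_word)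
    next
      case 3
      then have "H' T J m = H J m" by (simp add: H'_def)
      moreover have "H J m \<in> graded_maps (shift A) (shift B) m (- int (fdim J))"
        using PiE_mem[OF PiE_mem[OF H(1) 3]] m by auto
      ultimately show ?thesis by (simp add: graded_maps_homogeneous_word)
    qed
  qed
  have equation_iff: "morphism_equation A bA bB F (set L) m \<longleftrightarrow>
      (\<forall>w. length w = m \<longrightarrow> homogeneous_word (shift A) w \<longrightarrow> ?E F L w = 0)"
    if "sorted_wrt (<) L" "set L \<in> K" "1 \<le> m" for L F m
  proof (rule morphism_equation_iff_defect[OF that(1) _ _ _ that(3)])
    show "L \<noteq> []" "{} \<notin> K" using that(2) K by auto
    show "J \<in> K" if "J \<subseteq> set L" "J \<noteq> {}" for J using that \<open>set L \<in> K\<close> K by blast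
  qed
  have top_defect: "?E F I w = ?E (H' T) I w + signed (int k) (F D (length w) (map snd w))"
    if F: "\<And>J. J \<in> K - {top, D} \<Longrightarrow> F J = H J" "F top = T" for F T w
  proof -
    have "?E F I w = ?E (H' T) I w
        + signed (int k) (face_map K F (omit k I) w - face_map K (H' T) (omit k I) w)"
    proof (rule defect_omit[OF I(3) assms(4) I(6)])
      fix J assume J: "J \<noteq> omit k I"
      show "face_map K F J = face_map K (H' T) J"
      proof (cases "sorted_wrt (<) J \<and> set J \<in> K")
        case True
        have "set J \<noteq> D"
          using J True omit by (metis strict_sorted_iff sorted_distinct_set_unique)
        then have "F (set J) = H' T (set J)"
          using True F by (cases "set J = top") (auto simp: H'_def)
        then show ?thesis unfolding face_map_def[abs_def] word_map_def by (simp only:)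
      next
        case False
        then show ?thesis unfolding face_map_def by (simp only: if_False)
      qed
    qed
    then show ?thesis
      using omit D by (simp add: face_map_def word_map_def H'_def del: set_append)
  qed
  \<comment> \<open>The equation of the top face, solved for the value on the missing facet.\<close>
  have top_equation: "(\<forall>m\<ge>1. morphism_equation A bA bB F top m) \<longleftrightarrow>
      (\<forall>w. w \<noteq> [] \<longrightarrow> homogeneous_word (shift A) w \<longrightarrow>
         F D (length w) (map snd w) = - signed (int k) (?E (H' T) I w))"
    if F: "\<And>J. J \<in> K - {top, D} \<Longrightarrow> F J = H J" "F top = T" for F T
  proof -
    have solve: "x + signed (int k) y = 0 \<longleftrightarrow> y = - signed (int k) x" for x y :: 'b
      by (auto simp: signed_def add_eq_0_iff)
    have "(\<forall>m\<ge>1. morphism_equation A bA bB F top m) \<longleftrightarrow>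
        (\<forall>m\<ge>1. \<forall>w. length w = m \<longrightarrow> homogeneous_word (shift A) w \<longrightarrow> ?E F I w = 0)"
      using equation_iff[OF I(1), of _ F] top(1) unfolding I(4) by blast
    also have "\<dots> \<longleftrightarrow> (\<forall>w. w \<noteq> [] \<longrightarrow> homogeneous_word (shift A) w \<longrightarrow> ?E F I w = 0)"
      by (auto simp: Suc_le_eq)
    also have "\<dots> \<longleftrightarrow> (\<forall>w. w \<noteq> [] \<longrightarrow> homogeneous_word (shift A) w \<longrightarrow>
         F D (length w) (map snd w) = - signed (int k) (?E (H' T) I w))"
      by (simp only: top_defect[OF F] solve)
    finally show ?thesis .
  qed
  have filler: "F \<in> horn_fillers A bA B bB k n H \<longleftrightarrow>
      F \<in> HOM_on A bA B bB K \<and> restrict F (K - {top, D}) = H" for F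
    by (simp add: horn_fillers_def n_morphisms_def K_def[symmetric] horn)
  have on_horn: "F J = H J" if "F \<in> horn_fillers A bA B bB k n H" "J \<in> K - {top, D}" for F J
    using that unfolding filler by (metis restrict_apply')
  have graded: "F J m \<in> graded_maps (shift A) (shift B) m (- int (fdim J))"
    if "F \<in> HOM_on A bA B bB K" "J \<in> K" "1 \<le> m" for F J m
    using PiE_mem[OF PiE_mem[OF conjunct1[OF that(1)[unfolded HOM_on_iff]] that(2)]] that(3) by auto
  have top_mem: "F top \<in> (\<Pi>\<^sub>E m \<in> {1..}. graded_maps (shift A) (shift B) m (- int n))"
    if "F \<in> HOM_on A bA B bB K" for F
    using PiE_mem[OF conjunct1[OF that[unfolded HOM_on_iff]] top(1)] by (simp only: top(2))
  have inj: "inj_on (\<lambda>F. F top) (horn_fillers A bA B bB k n H)"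
  proof (rule inj_onI)
    fix F G assume F: "F \<in> horn_fillers A bA B bB k n H" and G: "G \<in> horn_fillers A bA B bB k n H"
      and eq: "F top = G top"
    have HOM: "F \<in> HOM_on A bA B bB K" "G \<in> HOM_on A bA B bB K" using F G filler by auto
    have D_solved: "P D (length w) (map snd w) = - signed (int k) (?E (H' (F top)) I w)"
      if P: "P \<in> {F, G}" and "w \<noteq> []" "homogeneous_word (shift A) w" for P w
    proof -
      have "P \<in> HOM_on A bA B bB K" using P HOM by blast
      then have "\<forall>m\<ge>1. morphism_equation A bA bB P top m" using top(1) unfolding HOM_on_iff by blast
      moreover have "P J = H J" if "J \<in> K - {top, D}" for J using that P F G on_horn by blast
      moreover have "P top = F top" using P eq by auto
      ultimately show ?thesis using top_equation[of P "F top"] that by blast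
    qed
    have "F D m = G D m" if m: "1 \<le> m" for m
    proof (rule extensionalityI)
      have FD: "F D m \<in> graded_maps (shift A) (shift B) m (- int (fdim D))"
        and GD: "G D m \<in> graded_maps (shift A) (shift B) m (- int (fdim D))"
        using graded HOM D(1) m by blast+
      then show "F D m \<in> extensional {xs. length xs = m}" "G D m \<in> extensional {xs. length xs = m}"
        by (simp_all add: graded_maps_homogeneous_word)
      fix xs :: "'a list" assume "xs \<in> {xs. length xs = m}"
      show "F D m xs = G D m xs"
      proof (rule sA.multilinear_ext)
        show "multilinear m (F D m)" "multilinear m (G D m)"
          using FD GD by (simp_all add: graded_maps_homogeneous_word)
        show "length xs = m" using \<open>xs \<in> _\<close> by simp
        fix w :: "'a word" assume "length w = m" "homogeneous_word (shift A) w"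
        moreover from this have "w \<noteq> []" using m by auto
        ultimately show "F D m (map snd w) = G D m (map snd w)"
          using D_solved[of F w] D_solved[of G w] m by auto
      qed
    qed
    moreover have "F D \<in> extensional {1..}" "G D \<in> extensional {1..}"
      using HOM D(1) unfolding HOM_on_iff by (auto dest!: PiE_mem simp: PiE_def)
    ultimately have FGD: "F D = G D" by (intro extensionalityI[of "F D" "{1..}"]) auto
    show "F = G"
    proof (rule extensionalityI)
      show "F \<in> extensional K" "G \<in> extensional K" using HOM unfolding HOM_on_iff by (auto simp: PiE_def)
      fix J assume "J \<in> K"
      then show "F J = G J"
        using FGD eq on_horn[OF F] on_horn[OF G] by (cases "J = D \<or> J = top") auto
    qed
  qed
  have surj: "\<exists>F. F \<in> horn_fillers A bA B bB k n H \<and> F top = T"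
    if T: "T \<in> (\<Pi>\<^sub>E m \<in> {1..}. graded_maps (shift A) (shift B) m (- int n))" for T
  proof -
    \<comment> \<open>The solution of the equation of the top face, on words of homogeneous elements.\<close>
    let ?G = "\<lambda>w. - signed (int k) (?E (H' T) I w)"
    note fam = fam_H'[OF T]
    have "multiadditive (total_codiff ?bA (face_map K (H' T)) I)"
      by (intro multiadditive_total_codiff A.multiadditive_b multiadditive_face_map[OF fam])
    moreover have "multiadditive (lift (face_map K (H' T)) ?bB I)"
      by (intro multiadditive_lift B.multiadditive_b multiadditive_face_map[OF fam])
    ultimately have "multiadditive ?G"
      by (simp add: multiadditive_def defect_def signed_add signed_diff)
    then have "\<exists>f. f \<in> extensional {xs. length xs = m} \<and> multilinear m f \<and>
        (\<forall>w. length w = m \<longrightarrow> homogeneous_word (shift A) w \<longrightarrow> f (map snd w) = ?G w)" for m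
      by (elim sA.multilinear_extension[of ?G m]) blast
    then obtain g where g: "\<And>m. g m \<in> extensional {xs. length xs = m}" "\<And>m. multilinear m (g m)"
        "\<And>m w. length w = m \<Longrightarrow> homogeneous_word (shift A) w \<Longrightarrow> g m (map snd w) = ?G w"
      by metis
    have G_mem: "?G w \<in> shift B (deg w - int (fdim D))" if w: "homogeneous_word (shift A) w" "w \<noteq> []" for w
    proof -
      have "?E (H' T) I w \<in> shift B (deg w - ldim I + 1)"
      proof (rule defect_mem[OF W])
        show "face_map K (H' T) J u \<in> shift B (deg u - ldim J)" if "homogeneous_word (shift A) u" "u \<noteq> []" for J u
          using face_map_mem[OF fam W that] K by simp
      qed (use w A.b_mem B.b_mem in auto)
      moreover have "deg w - ldim I + 1 = deg w - int (fdim D)" using I(5) D(3) by simp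
      ultimately have "?E (H' T) I w \<in> shift B (deg w - int (fdim D))" by (simp only:)
      then have "0 - signed (int k) (?E (H' T) I w) \<in> shift B (deg w - int (fdim D))"
        by (intro subgroup_setD[OF W])
      then show ?thesis by simp
    qed
    have g_mem: "g m \<in> graded_maps (shift A) (shift B) m (- int (fdim D))" if m: "1 \<le> m" for m
      unfolding graded_maps_homogeneous_word
    proof (intro conjI allI impI g(1,2))
      fix w :: "'a word" assume w: "length w = m" "homogeneous_word (shift A) w"
      then have "w \<noteq> []" using m by auto
      with w g(3)[OF w] G_mem[OF w(2)] show "g m (map snd w) \<in> shift B (deg w + - int (fdim D))"
        by simp
    qed
    define F where "F = (H' T)(D := restrict g {1..})"
    have F_eq: "F top = T" "F D = restrict g {1..}" "\<And>J. J \<in> K - {top, D} \<Longrightarrow> F J = H J"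
      using D(2) by (auto simp: F_def H'_def)
    have F_PiE: "F \<in> (\<Pi>\<^sub>E J \<in> K. \<Pi>\<^sub>E m \<in> {1..}. graded_maps (shift A) (shift B) m (- int (fdim J)))"
    proof (rule PiE_I)
      fix J assume J: "J \<in> K"
      consider "J = D" | "J = top" "J \<noteq> D" | "J \<in> K - {top, D}" using J by blast
      then show "F J \<in> (\<Pi>\<^sub>E m \<in> {1..}. graded_maps (shift A) (shift B) m (- int (fdim J)))"
      proof cases
        case 1
        then show ?thesis using g_mem by (auto simp: F_eq)
      next
        case 2
        then show ?thesis using T by (simp only: F_eq top(2))
      next
        case 3
        then show ?thesis using PiE_mem[OF H(1) 3] by (simp only: F_eq)
      qed
    next
      fix J assume J: "J \<notin> K"
      then have "J \<noteq> D" "J \<noteq> top" using D(1) top(1) by auto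
      then show "F J = undefined" using PiE_arb[OF H(1)] J by (simp add: F_def H'_def)
    qed
    have famF: "graded_family (shift A) (shift B) K F"
      unfolding graded_family_def
    proof (intro ballI allI impI)
      fix J and m :: nat assume "J \<in> K" "1 \<le> m"
      then have "F J m \<in> graded_maps (shift A) (shift B) m (- int (fdim J))"
        using PiE_mem[OF PiE_mem[OF F_PiE]] by auto
      then show "multilinear m (F J m) \<and> (\<forall>w. length w = m \<longrightarrow> homogeneous_word (shift A) w \<longrightarrow>
         F J m (map snd w) \<in> shift B (deg w - int (fdim J)))"
        by (simp add: graded_maps_homogeneous_word)
    qed
    have eq_horn: "morphism_equation A bA bB F J m" if J: "J \<in> K - {top, D}" and m: "1 \<le> m" for J m
    proof -
      have "morphism_equation A bA bB F J m \<longleftrightarrow> morphism_equation A bA bB H J m"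
      proof (rule morphism_equation_cong[OF _ _ m])
        show "finite J" "J \<noteq> {}" using J finK K by auto
        show "F J' = H J'" if "J' \<subseteq> J" "J' \<noteq> {}" for J'
          using that by (intro F_eq(3) horn_sub[OF J])
      qed
      with H(2)[OF J m] show ?thesis by simp
    qed
    have eq_top: "morphism_equation A bA bB F top m" if "1 \<le> m" for m
    proof -
      have "\<forall>m\<ge>1. morphism_equation A bA bB F top m"
        using top_equation[of F T, OF F_eq(3) F_eq(1)] g(3) by (auto simp: F_eq(2) Suc_le_eq)
      with that show ?thesis by blast
    qed
    \<comment> \<open>All faces other than the missing facet already satisfy their equations.\<close>
    have zero: "?E F L w = 0" if L: "sorted_wrt (<) L" "set L \<in> K" "set L \<noteq> D"
      and w: "homogeneous_word (shift A) w" "w \<noteq> []" for L w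
    proof -
      have len: "1 \<le> length w" using w(2) by (simp add: Suc_le_eq)
      have "morphism_equation A bA bB F (set L) (length w)"
        using eq_horn[OF _ len] eq_top[OF len] L by (cases "set L = top") auto
      then show ?thesis using equation_iff[OF L(1,2) len] w by blast
    qed
    \<comment> \<open>The equation of the missing facet is a consequence of the others by the Bianchi identity.\<close>
    have eq_D: "morphism_equation A bA bB F D m" if m: "1 \<le> m" for m
      unfolding omit(1)[symmetric]
    proof (subst equation_iff[OF omit(2) _ m], goal_cases)
      case 1
      show ?case unfolding omit(1) by (rule D)
    next
      case 2
      show ?case
      proof (intro allI impI)
        fix w :: "'a word" assume w: "length w = m" "homogeneous_word (shift A) w"
        then have ne: "w \<noteq> []" using m by auto
        show "?E F (omit k I) w = 0"
        proof (rule defect_omit_eq_0[OF I(3) assms(4) I(6) multiadditive_face_map[OF famF] _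
              B.multiadditive_b A.codiff_b A.b_mem _ w(2) ne])
          show "face_map K F [] u = 0" for u using K by (simp add: face_map_def)
          have "lift (face_map K F) (codiff ?bB ?bB) I w \<in> {0}"
          proof (rule lift_mem[where V = "shift A" and W = "shift B"])
            show "face_map K F J u \<in> shift B (deg u - ldim J)" if "homogeneous_word (shift A) u" "u \<noteq> []" for J u
              using face_map_mem[OF famF W that] K by simp
          qed (use w B.codiff_b subgroup_set_0 in auto)
          then show "lift (face_map K F) (codiff ?bB ?bB) I w = 0" by simp
        next
          fix L J M and u :: "'a word"
          assume J: "L @ J @ M = I" "J \<noteq> []" and u: "homogeneous_word (shift A) u" "u \<noteq> []"
          have sorted: "sorted_wrt (<) J" using I(1) J(1)[symmetric] by (simp add: sorted_wrt_append)
          have "J \<noteq> omit k I" using segment_neq_omit[OF I(3) assms(4) I(6) J(1)] .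
          then have "set J \<noteq> D"
            using sorted omit(1,2) by (metis strict_sorted_iff sorted_distinct_set_unique)
          moreover have "set J \<in> K" using J I(4) K by auto
          ultimately show "?E F J u = 0" using zero[OF sorted] u by blast
        next
          fix j assume j: "j < length I" "j \<noteq> k"
          have "omit j I \<noteq> omit k I" using omit_neq[OF I(3)] j I(6) by simp
          then have "set (omit j I) \<noteq> D"
            using sorted_omit[OF I(1)] omit(1,2) by (metis strict_sorted_iff sorted_distinct_set_unique)
          moreover have "set (omit j I) \<in> K"
          proof -
            have "length (omit j I) \<noteq> 0" using j(1) I(5) assms(3) by simp
            then have "set (omit j I) \<noteq> {}" by (metis length_0_conv set_empty)
            then show ?thesis using set_omit[OF I(3) j(1)] I(4) K by (metis Diff_subset)
          qed
          ultimately show "?E F (omit j I) w = 0"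
            using zero[OF sorted_omit[OF I(1)]] w(2) ne by blast
        qed
      qed
    qed
    have "F \<in> HOM_on A bA B bB K"
      unfolding HOM_on_iff using F_PiE eq_horn eq_top eq_D by blast
    moreover have "restrict F (K - {top, D}) = H"
    proof (rule extensionalityI[of _ "K - {top, D}"])
      show "H \<in> extensional (K - {top, D})" using H(1) by (simp add: PiE_def)
    qed (use F_eq(3) in auto)
    ultimately show ?thesis using filler F_eq(1) by blast
  qed
  have "(\<lambda>F. F top) ` horn_fillers A bA B bB k n H
      = (\<Pi>\<^sub>E m \<in> {1..}. graded_maps (shift A) (shift B) m (- int n))"
    using top_mem surj filler by blast
  with inj show ?thesis unfolding bij_betw_def top_def by blast
qed

end
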